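(* For each (sufficiently large) $n$ let $s=s_n\in\{1,\ldots,n\}$, $m=m_n>0$ and $\mu=\mu_n>0$, and let $\mathcal{C}$ be the class of all subsets of $\{1,\ldots,n\}$ of cardinality $s$. Assume $s>\log\log\log n$ and $$\mu>\sqrt{\frac{32\,n\log\log\log n}{sm}}.$$ Then there is an adaptive sensing testing strategy (a sensing strategy with total budget $m$ together with a test $\hat\Phi$ based on the resulting data) such that $$R(\hat\Phi)=\mathbb{P}_\emptyset(\hat\Phi\neq 0)+\max_{S\in\mathcal{C}}\mathbb{P}_S(\hat\Phi\neq 1)\ \longrightarrow\ 0\qquad\text{as }n\to\infty.$$
   Context: Signal model: for $S\subseteq\{1,\ldots,n\}$ the signal $\vec{x}\in\mathbb{R}^n$ with support $S$ is given by $x_i=\mu$ if $i\in S$ and $x_i=0$ otherwise. Adaptive sensing: one observes $Y_k=x_{A_k}+\Gamma_k^{-1}W_k$, $k=1,2,\ldots$, where $A_k\in\{1,\ldots,n\}$ is the entry measured at time $k$ and $\Gamma_k^2$ is the precision of that measurement. The pair $(A_k,\Gamma_k)$ is chosen as a (possibly randomized) function of the past $\{Y_i,A_i,\Gamma_i\}_{i=1}^{k-1}$; the $W_k$ are standard normal, each $W_k$ being independent of $\{Y_i\}_{i=1}^{k-1}$, $\{A_i,\Gamma_i\}_{i=1}^{k}$ (and of any extra randomization). The sensing strategy is the collection of conditional distributions of $(A_k,\Gamma_k)$ given $\{Y_i,A_i,\Gamma_i\}_{i=1}^{k-1}$, for all $k$; it does not depend on the unknown $S$. The budget constraint is $\sum_{k=1}^\infty\Gamma_k^2\le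 m$ (almost surely). Convention: $\Gamma_k=0$ is allowed and means that no (informative) measurement is made at step $k$. $\mathbb{P}_S$ denotes the law of $D=\{Y_i,A_i,\Gamma_i\}_{i\in\mathbb{N}}$ when the support is $S$. A test is a $\{0,1\}$-valued measurable function of $D$. *)

theory Defs
  imports "HOL-Probability.Probability"
begin

definition signal :: "real \<Rightarrow> nat set \<Rightarrow> nat \<Rightarrow> real" where
  "signal \<mu> S i = (if i \<in> S then \<mu> else 0)"

text \<open>The space of pairs \<open>(A, \<Gamma>)\<close>: the measured entry and the square root of the precision.
  Nothing is lost by taking \<open>\<Gamma> \<ge> 0\<close>, as the noise is symmetric.\<close>

definition setting_space :: "nat \<Rightarrow> (nat \<times> real) measure" where
  "setting_space n = count_space {1..n} \<Otimes>\<^sub>M restrict_space borel {0..}"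

text \<open>The space of triples \<open>(Y, A, \<Gamma>)\<close>.\<close>

definition step_space :: "nat \<Rightarrow> (real \<times> nat \<times> real) measure" where
  "step_space n = borel \<Otimes>\<^sub>M setting_space n"

text \<open>Steps are numbered from 0, so the history before step \<open>k\<close> is indexed by \<open>{0..<k}\<close>.\<close>

definition history_space :: "nat \<Rightarrow> nat \<Rightarrow> (nat \<Rightarrow> real \<times> nat \<times> real) measure" where
  "history_space n k = PiM {0..<k} (\<lambda>_. step_space n)"

definition data_space :: "nat \<Rightarrow> (nat \<Rightarrow> real \<times> nat \<times> real) measure" where
  "data_space n = PiM UNIV (\<lambda>_. step_space n)"

definition precision :: "(nat \<Rightarrow> real \<times> nat \<times> real) \<Rightarrow> nat \<Rightarrow> real" where
  "precision D k = (snd (snd (D k)))\<^sup>2"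

text \<open>A sensing strategy gives, for each step, the conditional distribution (a Markov kernel) of
  \<open>(A, \<Gamma>)\<close> given the history. It does not involve the signal.\<close>

type_synonym sensing = "nat \<Rightarrow> (nat \<Rightarrow> real \<times> nat \<times> real) \<Rightarrow> (nat \<times> real) measure"

definition sensing_strategy :: "nat \<Rightarrow> sensing \<Rightarrow> bool" where
  "sensing_strategy n K \<longleftrightarrow>
     (\<forall>k. K k \<in> history_space n k \<rightarrow>\<^sub>M prob_algebra (setting_space n))"

text \<open>The value \<open>\<gamma> = 0\<close> stands for no measurement, so the response must not depend on \<open>x\<close> then;
  this case cannot be left to the convention \<open>inverse 0 = 0\<close>, which would reveal \<open>x a\<close> exactly.\<close>

definition response :: "(nat \<Rightarrow> real) \<Rightarrow> nat \<Rightarrow> real \<Rightarrow> real \<Rightarrow> real" where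
  "response x a \<gamma> w = (if \<gamma> = 0 then 0 else x a + inverse \<gamma> * w)"

text \<open>The conditional law of \<open>(Y, A, \<Gamma>)\<close> at step \<open>k\<close> given the history \<open>h\<close>. The product measure
  expresses that the noise is standard normal and independent of \<open>(A, \<Gamma>)\<close> and of the past.\<close>

definition step_law :: "nat \<Rightarrow> (nat \<Rightarrow> real) \<Rightarrow> sensing \<Rightarrow> nat \<Rightarrow>
    (nat \<Rightarrow> real \<times> nat \<times> real) \<Rightarrow> (real \<times> nat \<times> real) measure" where
  "step_law n x K k h = distr (K k h \<Otimes>\<^sub>M std_normal_distribution) (step_space n)
     (\<lambda>((a, \<gamma>), w). (response x a \<gamma> w, a, \<gamma>))"

text \<open>The law of the whole data sequence is the measure with these conditional laws, given by the
  Ionescu-Tulcea theorem.\<close>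

definition data_law :: "nat \<Rightarrow> (nat \<Rightarrow> real) \<Rightarrow> sensing \<Rightarrow> (nat \<Rightarrow> real \<times> nat \<times> real) measure" where
  "data_law n x K = projective_family.lim UNIV
     (Ionescu_Tulcea.CI (step_law n x K) (\<lambda>_. step_space n)) (\<lambda>_. step_space n)"

definition support_law :: "nat \<Rightarrow> real \<Rightarrow> sensing \<Rightarrow> nat set \<Rightarrow>
    (nat \<Rightarrow> real \<times> nat \<times> real) measure" where
  "support_law n \<mu> K S = data_law n (signal \<mu> S) K"

text \<open>The sum is taken in \<open>ennreal\<close>, so that divergence counts as exceeding the budget.\<close>

definition within_budget :: "nat \<Rightarrow> real \<Rightarrow> real \<Rightarrow> sensing \<Rightarrow> bool" where
  "within_budget n \<mu> m K \<longleftrightarrow>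
     (\<forall>S \<subseteq> {1..n}. AE D in support_law n \<mu> K S. (\<Sum>k. ennreal (precision D k)) \<le> ennreal m)"

definition is_test :: "nat \<Rightarrow> ((nat \<Rightarrow> real \<times> nat \<times> real) \<Rightarrow> nat) \<Rightarrow> bool" where
  "is_test n \<Phi> \<longleftrightarrow> \<Phi> \<in> data_space n \<rightarrow>\<^sub>M count_space {0, 1}"

definition support_class :: "nat \<Rightarrow> nat \<Rightarrow> nat set set" where
  "support_class n s = {S. S \<subseteq> {1..n} \<and> card S = s}"

definition risk :: "nat \<Rightarrow> real \<Rightarrow> nat set set \<Rightarrow> sensing \<Rightarrow>
    ((nat \<Rightarrow> real \<times> nat \<times> real) \<Rightarrow> nat) \<Rightarrow> real" where
  "risk n \<mu> \<C> K \<Phi> =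
     measure (support_law n \<mu> K {}) {D \<in> space (data_space n). \<Phi> D \<noteq> 0} +
     (MAX S\<in>\<C>. measure (support_law n \<mu> K S) {D \<in> space (data_space n). \<Phi> D \<noteq> 1})"

text \<open>For a sensing strategy the step laws are Markov kernels, so the Ionescu-Tulcea theorem
  applies and \<open>data_law\<close> is the probability measure it provides.\<close>

lemma measurable_step_law:
  assumes "sensing_strategy n K"
  shows "step_law n x K k \<in> PiM {0..<k} (\<lambda>_. step_space n) \<rightarrow>\<^sub>M prob_algebra (step_space n)"
proof -
  have K: "K k \<in> PiM {0..<k} (\<lambda>_. step_space n) \<rightarrow>\<^sub>M prob_algebra (setting_space n)"
    using assms by (auto simp: sensing_strategy_def history_space_def)
  have N: "(\<lambda>_. std_normal_distribution) \<in>
      PiM {0..<k} (\<lambda>_. step_space n) \<rightarrow>\<^sub>M prob_algebra borel"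
    by (intro measurable_const) (simp add: space_prob_algebra prob_space_normal_density)
  have g: "(\<lambda>p. snd (fst p)) \<in> setting_space n \<Otimes>\<^sub>M borel \<rightarrow>\<^sub>M (borel :: real measure)"
    unfolding setting_space_def
    by (rule measurable_compose[OF measurable_compose[OF measurable_fst measurable_snd]])
       (simp add: measurable_restrict_space1)
  have xa: "(\<lambda>p. x (fst (fst p))) \<in> setting_space n \<Otimes>\<^sub>M borel \<rightarrow>\<^sub>M (borel :: real measure)"
    unfolding setting_space_def
    by (rule measurable_compose[OF measurable_compose[OF measurable_fst measurable_fst]]) simp
  note [measurable] = g xa
  have "(\<lambda>p. (response x (fst (fst p)) (snd (fst p)) (snd p), fst p))
      \<in> setting_space n \<Otimes>\<^sub>M borel \<rightarrow>\<^sub>M step_space n"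
    unfolding step_space_def response_def by measurable
  then have f: "(\<lambda>((a, \<gamma>), w). (response x a \<gamma> w, a, \<gamma>))
      \<in> setting_space n \<Otimes>\<^sub>M borel \<rightarrow>\<^sub>M step_space n"
    by (simp add: case_prod_beta')
  show ?thesis
    using measurable_compose[OF measurable_pair_prob[OF K N] measurable_distr_prob_space[OF f]]
    by (simp add: step_law_def[abs_def])
qed

lemma Ionescu_Tulcea_step_law:
  assumes "sensing_strategy n K"
  shows "Ionescu_Tulcea (step_law n x K) (\<lambda>_. step_space n)"
proof (rule Ionescu_Tulcea.intro)
  show "step_law n x K k \<in> PiM {0..<k} (\<lambda>_. step_space n) \<rightarrow>\<^sub>M subprob_algebra (step_space n)"
    for k
    by (rule measurable_prob_algebraD[OF measurable_step_law[OF assms]])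
  show "prob_space (step_law n x K k h)" if "h \<in> space (PiM {0..<k} (\<lambda>_. step_space n))" for k h
    using that measurable_space[OF measurable_step_law[OF assms]] by (auto simp: space_prob_algebra)
qed

lemma sets_data_law:
  assumes "sensing_strategy n K"
  shows "sets (data_law n x K) = sets (data_space n)"
proof -
  interpret Ionescu_Tulcea "step_law n x K" "\<lambda>_. step_space n"
    by (rule Ionescu_Tulcea_step_law[OF assms])
  show ?thesis by (simp add: data_law_def data_space_def)
qed

lemma prob_space_data_law:
  assumes "sensing_strategy n K"
  shows "prob_space (data_law n x K)"
proof -
  interpret Ionescu_Tulcea "step_law n x K" "\<lambda>_. step_space n"
    by (rule Ionescu_Tulcea_step_law[OF assms])
  have [simp]: "PF.emb UNIV {} {\<lambda>_. undefined} = space (PiM UNIV (\<lambda>_. step_space n))"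
    by (auto simp: prod_emb_def space_PiM)
  interpret CI: prob_space "CI {}" by (rule PF.prob_space_P) auto
  have "emeasure PF.lim (PF.emb UNIV {} {\<lambda>_. undefined}) = emeasure (CI {}) {\<lambda>_. undefined}"
    by (rule lim) (auto simp: PiM_empty)
  also have "\<dots> = 1"
    using CI.emeasure_space_1 by (simp add: CI_def space_PiM)
  finally show ?thesis
    by (intro prob_spaceI) (simp add: data_law_def)
qed

end

theory Submission
  imports Defs "HOL-Real_Asymp.Real_Asymp"
begin

text \<open>Write \<open>L = ln (ln (ln n))\<close> and \<open>r = n / s\<close>. Draw about \<open>r \<kappa>\<close> entries independently and
  uniformly, where \<open>\<kappa>\<close> tends to infinity and \<open>\<kappa>\<^sup>2\<close> is of smaller order than \<open>L\<close>; then with high probability many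
  draws hit the support. Test each drawn entry in \<open>J\<close> rounds of precision \<open>16 (j + 1) / \<mu>\<^sup>2\<close>,
  continuing only while the response exceeds \<open>\<mu> / 2\<close>. Round \<open>j\<close> errs with probability at most
  \<open>4 ^ - (j + 1)\<close>, so an entry of the support passes all rounds with probability at least \<open>1 / 2\<close>, an
  entry outside it with probability at most \<open>4 ^ - J\<close>, and the expected precision spent on the latter
  is only of order \<open>1 / \<mu>\<^sup>2\<close>. The total expected precision is therefore of smaller order than
  \<open>r L / \<mu>\<^sup>2\<close>, hence than \<open>m\<close>, and by Markov's inequality refusing every measurement that would
  exceed the budget has a negligible effect.\<close>

section \<open>Integration along the data law, Gaussian tails\<close>

text \<open>The tower property. The marginal of the Ionescu-Tulcea measure on the first
  \<open>k\<close> steps is the iterated kernel \<open>C 0 k\<close>, and \<open>C 0 (Suc k)\<close>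
  appends one step drawn from \<open>step_law\<close>. The one-step probabilities below are reduced
  to this.\<close>

lemma nn_integral_data_law_Suc:
  assumes K: "sensing_strategy n K"
    and f: "f \<in> borel_measurable (history_space n (Suc k))"
  shows "(\<integral>\<^sup>+D. f (restrict D {0..<Suc k}) \<partial>data_law n x K) =
    (\<integral>\<^sup>+D. \<integral>\<^sup>+y. f ((restrict D {0..<k})(k := y)) \<partial>step_law n x K k (restrict D {0..<k}) \<partial>data_law n x K)"
proof -
  interpret Ionescu_Tulcea "step_law n x K" "\<lambda>_. step_space n"
    by (rule Ionescu_Tulcea_step_law[OF K])
  \<comment> \<open>\<open>CI\<close> passes through the least initial segment that contains the
    index set; for \<open>{0..<k}\<close> this is the set itself, so no projection remains.\<close>
  have up: "up_to {0..<k} = k" for k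
  proof (cases k)
    case (Suc i)
    then show ?thesis
      using up_to_less[of "{0..<k}" i] up_to_iff[of "{0..<k}" k] by simp
  next
    case 0
    then show ?thesis
      using up_to_iff[of "{0..<k}" k] by simp
  qed
  have CI: "CI {0..<k} = C 0 k (\<lambda>_. undefined)" for k
    using distr_C[of k k "\<lambda>_. undefined" 0] by (simp add: CI_def up)
  have restr: "distr (data_law n x K) (PiM {0..<k} (\<lambda>_. step_space n)) (\<lambda>D. restrict D {0..<k}) =
      C 0 k (\<lambda>_. undefined)" for k
    unfolding data_law_def by (subst distr_lim) (simp_all add: CI)
  have setsD: "sets (data_law n x K) = sets (PiM UNIV (\<lambda>_. step_space n))"
    using sets_data_law[OF K] by (simp add: data_space_def)
  have meas: "(\<lambda>D. restrict D {0..<k}) \<in>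
      data_law n x K \<rightarrow>\<^sub>M PiM {0..<k} (\<lambda>_. step_space n)" for k
    unfolding measurable_cong_sets[OF setsD refl] by (rule measurable_restrict_subset) simp
  have f': "f \<in> borel_measurable (PiM {0..<Suc k} (\<lambda>_. step_space n))"
    using f by (simp add: history_space_def)
  have g: "(\<lambda>h. integral\<^sup>N (eP k h) f) \<in> borel_measurable (PiM {0..<k} (\<lambda>_. step_space n))"
    by (rule measurable_compose[OF measurable_eP nn_integral_measurable_subprob_algebra[OF f']])
  have "(\<integral>\<^sup>+D. f (restrict D {0..<Suc k}) \<partial>data_law n x K) = integral\<^sup>N (C 0 (Suc k) (\<lambda>_. undefined)) f"
    unfolding restr[symmetric] by (rule nn_integral_distr[symmetric, OF meas]) (use f' in simp)
  also have "\<dots> = (\<integral>\<^sup>+h. integral\<^sup>N (eP k h) f \<partial>C 0 k (\<lambda>_. undefined))"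
    using f' by (simp, subst nn_integral_bind[where B = "PiM {0..<Suc k} (\<lambda>_. step_space n)"]) (auto simp: measurable_cong_sets[OF sets_C refl])
  also have "\<dots> = (\<integral>\<^sup>+D. integral\<^sup>N (eP k (restrict D {0..<k})) f \<partial>data_law n x K)"
    unfolding restr[symmetric] by (subst nn_integral_distr[OF meas]) (use g in simp_all) 
  also have "\<dots> = (\<integral>\<^sup>+D. \<integral>\<^sup>+y. f ((restrict D {0..<k})(k := y))
      \<partial>step_law n x K k (restrict D {0..<k}) \<partial>data_law n x K)"
    by (intro nn_integral_cong nn_integral_eP f' measurable_space[OF meas])
  finally show ?thesis .
qed

text \<open>On this event the standard normal density is at most
  \<open>exp (- c\<^sup>2 / 2)\<close> times the normal density centred at
  \<open>\<sigma> * c\<close>, which has mass 1. The sign \<open>\<sigma>\<close> covers the upper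
  and the lower tail at once.\<close>

lemma emeasure_std_normal_tail:
  fixes c \<sigma> :: real
  assumes c: "c \<ge> 0" and \<sigma>: "\<sigma>\<^sup>2 = 1"
  shows "emeasure std_normal_distribution {w. c \<le> \<sigma> * w} \<le> ennreal (exp (- c\<^sup>2 / 2))"
proof -
  have "emeasure std_normal_distribution {w. c \<le> \<sigma> * w} =
      (\<integral>\<^sup>+w. ennreal (std_normal_density w) * indicator {w. c \<le> \<sigma> * w} w \<partial>lborel)"
    by (rule emeasure_density) auto
  also have "\<dots> \<le> (\<integral>\<^sup>+w. ennreal (exp (- c\<^sup>2 / 2)) * ennreal (normal_density (\<sigma> * c) 1 w) \<partial>lborel)"
  proof (rule nn_integral_mono)
    fix w :: real
    have "std_normal_density w \<le> exp (- c\<^sup>2 / 2) * normal_density (\<sigma> * c) 1 w" if "c \<le> \<sigma> * w"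
    proof -
      have "c * c \<le> c * (\<sigma> * w)" using that c by (rule mult_left_mono)
      moreover have "(\<sigma> * c)\<^sup>2 = c\<^sup>2" by (simp add: power_mult_distrib \<sigma>)
      ultimately have "- (w\<^sup>2 / 2) \<le> - (c\<^sup>2 / 2) + - (w - \<sigma> * c)\<^sup>2 / 2"
        by (simp add: power2_diff) (simp add: power2_eq_square algebra_simps)
      then show ?thesis
        by (simp add: normal_density_def exp_add[symmetric] divide_right_mono)
    qed
    then show "ennreal (std_normal_density w) * indicator {w. c \<le> \<sigma> * w} w
        \<le> ennreal (exp (- c\<^sup>2 / 2)) * ennreal (normal_density (\<sigma> * c) 1 w)"
      by (auto split: split_indicator simp: ennreal_mult[symmetric] intro!: ennreal_leI)
  qed
  also have "\<dots> = ennreal (exp (- c\<^sup>2 / 2))"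
    by (simp add: nn_integral_cmult nn_integral_eq_integral)
  finally show ?thesis .
qed

section \<open>Measurability of single steps, accumulated precision\<close>

lemma measurable_response:
  "(\<lambda>((a, \<gamma>), w). (response x a \<gamma> w, a, \<gamma>)) \<in> setting_space n \<Otimes>\<^sub>M borel \<rightarrow>\<^sub>M step_space n"
proof -
  have g: "(\<lambda>p. snd (fst p)) \<in> setting_space n \<Otimes>\<^sub>M borel \<rightarrow>\<^sub>M (borel :: real measure)"
    unfolding setting_space_def
    by (rule measurable_compose[OF measurable_compose[OF measurable_fst measurable_snd]])
       (simp add: measurable_restrict_space1)
  have xa: "(\<lambda>p. x (fst (fst p))) \<in> setting_space n \<Otimes>\<^sub>M borel \<rightarrow>\<^sub>M (borel :: real measure)"
    unfolding setting_space_def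
    by (rule measurable_compose[OF measurable_compose[OF measurable_fst measurable_fst]]) simp
  note [measurable] = g xa
  have "(\<lambda>p. (response x (fst (fst p)) (snd (fst p)) (snd p), fst p))
      \<in> setting_space n \<Otimes>\<^sub>M borel \<rightarrow>\<^sub>M step_space n"
    unfolding step_space_def response_def by measurable
  then show ?thesis
    by (simp add: case_prod_beta')
qed

lemma measurable_fst_step_space: "fst \<in> borel_measurable (step_space n)"
  by (simp add: step_space_def)

lemma measurable_entry_step_space: "(\<lambda>y. fst (snd y)) \<in> step_space n \<rightarrow>\<^sub>M count_space {1..n}"
  unfolding step_space_def setting_space_def
  by (rule measurable_compose[OF measurable_snd measurable_fst])

lemma measurable_snd_step_space: "(\<lambda>y. snd (snd y)) \<in> borel_measurable (step_space n)"
  unfolding step_space_def setting_space_def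
  by (rule measurable_compose[OF measurable_compose[OF measurable_snd measurable_snd]])
     (simp add: measurable_restrict_space1)

lemma measurable_step:
  "j \<in> I \<Longrightarrow> (\<lambda>h. h j) \<in> PiM I (\<lambda>_. step_space n) \<rightarrow>\<^sub>M step_space n"
  by (rule measurable_component_singleton)

definition spent :: "nat \<Rightarrow> (nat \<Rightarrow> real \<times> nat \<times> real) \<Rightarrow> real" where
  "spent k D = (\<Sum>i<k. precision D i)"

lemma measurable_spent:
  assumes "{0..<k} \<subseteq> I"
  shows "spent k \<in> borel_measurable (PiM I (\<lambda>_. step_space n))"
  unfolding spent_def precision_def
  using assms
  by (intro borel_measurable_sum borel_measurable_power
      measurable_compose[OF measurable_step measurable_snd_step_space]) auto

lemma spent_restrict: "{0..<k} \<subseteq> I \<Longrightarrow> spent k (restrict D I) = spent k D"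
  by (auto simp: spent_def precision_def intro!: sum.cong)

lemma precision_nonneg: "0 \<le> precision D k"
  by (simp add: precision_def)

lemma spent_mono: "j \<le> k \<Longrightarrow> spent j D \<le> spent k D"
  unfolding spent_def by (rule sum_mono2) (auto simp: precision_nonneg)

lemma spent_Suc: "spent (Suc k) D = spent k D + precision D k"
  by (simp add: spent_def)

text \<open>The time steps are grouped into \<open>T\<close> blocks of length \<open>J\<close>. Block \<open>t\<close> tests one uniformly drawn
  entry in up to \<open>J\<close> rounds, round \<open>j\<close> taking place at time \<open>t * J + j\<close>.\<close>

locale sequential_scan =
  fixes n J T :: nat and m \<mu> :: real
  assumes n: "n \<ge> 1" and J: "J \<ge> 1" and m: "m > 0" and \<mu>: "\<mu> > 0"
begin

section \<open>The sequential scan and its test\<close>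

text \<open>Linear growth in the round makes the error probabilities of the rounds geometric, while
  all \<open>J\<close> rounds together cost only of order
  \<open>J\<^sup>2 / \<mu>\<^sup>2\<close>.\<close>

definition round_precision :: "nat \<Rightarrow> real" where
  "round_precision j = 16 * (real j + 1) / \<mu>\<^sup>2"

text \<open>A refused measurement counts as a failed round, whatever value is recorded with
  it.\<close>

definition passed :: "real \<times> nat \<times> real \<Rightarrow> bool" where
  "passed y \<longleftrightarrow> snd (snd y) \<noteq> 0 \<and> fst y > \<mu> / 2"

text \<open>Consulting the previous step is enough: a failed or refused round is not
  \<open>passed\<close>, so the rest of its block stays silent. The check on \<open>spent\<close>
  builds the budget into the rule.\<close>

definition next_gamma :: "nat \<Rightarrow> (nat \<Rightarrow> real \<times> nat \<times> real) \<Rightarrow> real" where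
  "next_gamma k h =
     (if k < T * J \<and> (k mod J = 0 \<or> passed (h (k - 1))) \<and> spent k h + round_precision (k mod J) \<le> m
      then sqrt (round_precision (k mod J)) else 0)"

text \<open>A uniform \<open>i\<close> is drawn at every step but read only when a block starts;
  later rounds copy the entry of the round before. The kernel thus has the same form at all
  steps.\<close>

definition next_entry :: "nat \<Rightarrow> (nat \<Rightarrow> real \<times> nat \<times> real) \<Rightarrow> nat \<Rightarrow> nat" where
  "next_entry k h i = (if k mod J = 0 then i else fst (snd (h (k - 1))))"

definition scan :: sensing where
  "scan k h = distr (uniform_count_measure {1..n}) (setting_space n)
     (\<lambda>i. (next_entry k h i, next_gamma k h))"

text \<open>A round takes place only after the previous one was passed, so passing the last round of
  a block stands for passing all of them.\<close>

definition scan_test :: "(nat \<Rightarrow> real \<times> nat \<times> real) \<Rightarrow> nat" where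
  "scan_test D = (if \<exists>t<T. passed (D (t * J + (J - 1))) then 1 else 0)"

lemma round_precision_pos: "round_precision j > 0"
  using \<mu> by (simp add: round_precision_def)

lemma round_precision_mono: "i \<le> j \<Longrightarrow> round_precision i \<le> round_precision j"
  by (auto simp: round_precision_def intro!: divide_right_mono)

lemma next_gamma_nonneg: "next_gamma k h \<ge> 0"
  using round_precision_pos[of "k mod J"] by (simp add: next_gamma_def)

lemma next_gamma_nonzero: "next_gamma k h \<noteq> 0 \<Longrightarrow> next_gamma k h = sqrt (round_precision (k mod J))"
  by (simp add: next_gamma_def split: if_splits)

section \<open>Measurability of the scan rule\<close>

text \<open>Step 0 starts a block, so inside a block \<open>k - 1\<close> is a true predecessor and
  belongs to the history. At \<open>k = 0\<close> truncated subtraction would point to a step not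
  yet made, hence the case splits on \<open>k mod J = 0\<close> below.\<close>

lemma mod_J_nonzero: "k mod J \<noteq> 0 \<Longrightarrow> k - 1 < k"
  by (cases k) auto

lemma measurable_passed: "Measurable.pred (step_space n) passed"
proof -
  have [measurable]: "Measurable.pred (step_space n) (\<lambda>y. snd (snd y) \<noteq> 0)"
    by (rule measurable_compose[OF measurable_snd_step_space, of "\<lambda>z. z \<noteq> 0"]) simp
  have [measurable]: "Measurable.pred (step_space n) (\<lambda>y. fst y > \<mu> / 2)"
    by (rule measurable_compose[OF measurable_fst_step_space, of "\<lambda>z. z > \<mu> / 2"]) simp
  show ?thesis unfolding passed_def[abs_def] by measurable
qed

lemma measurable_next_gamma:
  assumes I: "{0..<k} \<subseteq> I"
  shows "next_gamma k \<in> borel_measurable (PiM I (\<lambda>_. step_space n))"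
proof -
  have Q: "Measurable.pred (PiM I (\<lambda>_. step_space n)) (\<lambda>h. k mod J = 0 \<or> passed (h (k - 1)))"
  proof (cases "k mod J = 0")
    case True
    then have "(\<lambda>h. k mod J = 0 \<or> passed (h (k - 1))) = (\<lambda>_. True)" by simp
    then show ?thesis by (simp only: measurable_const space_count_space UNIV_I)
  next
    case False
    then have "k - 1 \<in> I" using mod_J_nonzero[OF False] I by auto
    note p = measurable_compose[OF measurable_step[OF this] measurable_passed]
    have "(\<lambda>h. k mod J = 0 \<or> passed (h (k - 1))) = (\<lambda>h. passed (h (k - 1)))" using False by simp
    with p show ?thesis by (simp only:)
  qed
  have "(\<lambda>h. if A \<and> Q h \<and> f h + c \<le> m then a else 0) \<in> borel_measurable M"
    if [measurable]: "Measurable.pred M Q" "f \<in> borel_measurable M"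
    for M :: "(nat \<Rightarrow> real \<times> nat \<times> real) measure" and Q f A and a c :: real
    by measurable
  from this[OF Q measurable_spent[OF I]] show ?thesis
    unfolding next_gamma_def[abs_def] .
qed

lemma measurable_next_entry:
  assumes I: "{0..<k} \<subseteq> I"
  shows "(\<lambda>(h, i). next_entry k h i) \<in>
    PiM I (\<lambda>_. step_space n) \<Otimes>\<^sub>M count_space {1..n} \<rightarrow>\<^sub>M count_space {1..n}"
proof (cases "k mod J = 0")
  case True
  then show ?thesis
    unfolding next_entry_def[abs_def] case_prod_beta' by (simp only: if_True measurable_snd simp_thms)
next
  case False
  then have "k - 1 \<in> I" using mod_J_nonzero[OF False] I by auto
  note * = measurable_compose[OF measurable_fst measurable_compose[OF measurable_step[OF this] measurable_entry_step_space]]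
  show ?thesis
    unfolding next_entry_def[abs_def] case_prod_beta' using False * by (simp only: if_False)
qed

lemma next_gamma_restrict: "next_gamma k (restrict D {0..<k}) = next_gamma k D"
  using mod_J_nonzero[of k] by (cases "k mod J = 0") (simp_all add: next_gamma_def spent_restrict)

lemma next_entry_restrict: "next_entry k (restrict D {0..<k}) i = next_entry k D i"
  using mod_J_nonzero[of k] by (cases "k mod J = 0") (simp_all add: next_entry_def)

lemma prob_space_uniform: "prob_space (uniform_count_measure {1..n})"
  using n by (intro prob_space_uniform_count_measure) auto

lemma measurable_next_setting:
  "(\<lambda>(h, i). (next_entry k h i, next_gamma k h)) \<in>
    history_space n k \<Otimes>\<^sub>M uniform_count_measure {1..n} \<rightarrow>\<^sub>M setting_space n"
proof -
  have sets: "sets (history_space n k \<Otimes>\<^sub>M uniform_count_measure {1..n}) =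
      sets (PiM {0..<k} (\<lambda>_. step_space n) \<Otimes>\<^sub>M count_space {1..n})"
    by (auto simp: history_space_def sets_uniform_count_measure_count_space intro!: sets_pair_measure_cong)
  show ?thesis
    unfolding measurable_cong_sets[OF sets refl] setting_space_def case_prod_beta'
    by (intro measurable_Pair measurable_restrict_space2 measurable_next_entry[unfolded case_prod_beta']
        measurable_compose[OF measurable_fst measurable_next_gamma])
      (auto simp: next_gamma_nonneg)
qed

lemma sensing_strategy_scan: "sensing_strategy n scan"
  unfolding sensing_strategy_def scan_def[abs_def]
  by (intro allI measurable_distr_prob_space2[OF _ measurable_next_setting] measurable_const)
     (simp add: space_prob_algebra prob_space_uniform del: One_nat_def)

section \<open>Integrating out one step of the scan\<close>

text \<open>Given the history, the setting is the image of a uniform draw, and the response is a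
  function of setting and noise; change of variables and Fubini leave an average over these two
  sources.\<close>

lemma nn_integral_step_law_scan:
  assumes h: "h \<in> space (history_space n k)" and f: "f \<in> borel_measurable (step_space n)"
  shows "(\<integral>\<^sup>+y. f y \<partial>step_law n x scan k h) =
    (\<integral>\<^sup>+i. \<integral>\<^sup>+w. f (response x (next_entry k h i) (next_gamma k h) w, next_entry k h i, next_gamma k h)
      \<partial>std_normal_distribution \<partial>uniform_count_measure {1..n})"
proof -
  interpret N: prob_space std_normal_distribution
    by (rule prob_space_normal_density) simp
  let ?g = "\<lambda>((a, \<gamma>), w). (response x a \<gamma> w, a, \<gamma>)"
  have sets: "sets (scan k h \<Otimes>\<^sub>M std_normal_distribution) = sets (setting_space n \<Otimes>\<^sub>M borel)"
    by (intro sets_pair_measure_cong) (auto simp: scan_def)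
  have g: "?g \<in> scan k h \<Otimes>\<^sub>M std_normal_distribution \<rightarrow>\<^sub>M step_space n"
    unfolding measurable_cong_sets[OF sets refl] by (rule measurable_response)
  have fg: "(\<lambda>p. f (?g p)) \<in> borel_measurable (scan k h \<Otimes>\<^sub>M std_normal_distribution)"
    by (rule measurable_compose[OF g f])
  have set: "(\<lambda>i. (next_entry k h i, next_gamma k h)) \<in>
      uniform_count_measure {1..n} \<rightarrow>\<^sub>M setting_space n"
    using measurable_Pair2[OF measurable_next_setting h] by simp
  have "(\<integral>\<^sup>+y. f y \<partial>step_law n x scan k h) = (\<integral>\<^sup>+p. f (?g p) \<partial>(scan k h \<Otimes>\<^sub>M std_normal_distribution))"
    unfolding step_law_def by (subst nn_integral_distr[OF g]) (use f in simp_all)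
  also have "\<dots> = (\<integral>\<^sup>+q. \<integral>\<^sup>+w. f (?g (q, w)) \<partial>std_normal_distribution \<partial>scan k h)"
    by (rule N.nn_integral_fst[symmetric, OF fg])
  also have "\<dots> = (\<integral>\<^sup>+i. \<integral>\<^sup>+w. f (?g ((next_entry k h i, next_gamma k h), w))
      \<partial>std_normal_distribution \<partial>uniform_count_measure {1..n})"
    using N.borel_measurable_nn_integral_fst[OF fg] unfolding scan_def
    by (subst nn_integral_distr[OF set]) simp_all
  finally show ?thesis by simp
qed

text \<open>The assumption \<open>local\<close> lets \<open>G\<close> be written on whole sequences
  although it reads only the coordinates before \<open>k\<close>, so later events need no explicit
  restriction.\<close>

lemma measurable_history_step:
  assumes G: "(\<lambda>(h, y). G h y) \<in> history_space n k \<Otimes>\<^sub>M step_space n \<rightarrow>\<^sub>M L"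
    and local: "\<And>D y. G (restrict D {0..<k}) y = G D y"
  shows "(\<lambda>D. G D (D k)) \<in> data_space n \<rightarrow>\<^sub>M L"
proof -
  have "(\<lambda>D. (restrict D {0..<k}, D k)) \<in> data_space n \<rightarrow>\<^sub>M history_space n k \<Otimes>\<^sub>M step_space n"
    unfolding data_space_def history_space_def
    by (intro measurable_Pair measurable_restrict_subset measurable_step) auto
  from measurable_compose[OF this G] show ?thesis
    by (simp add: local)
qed

text \<open>The tower property in the form used from here on: given the past, step \<open>k\<close>
  can be rebuilt from a fresh draw and fresh noise.\<close>

lemma nn_integral_scan_step:
  assumes G: "(\<lambda>(h, y). G h y) \<in> borel_measurable (history_space n k \<Otimes>\<^sub>M step_space n)"
    and local: "\<And>D y. G (restrict D {0..<k}) y = G D y"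
  shows "(\<integral>\<^sup>+D. G D (D k) \<partial>data_law n x scan) =
    (\<integral>\<^sup>+D. \<integral>\<^sup>+i. \<integral>\<^sup>+w. G D (response x (next_entry k D i) (next_gamma k D) w,
        next_entry k D i, next_gamma k D)
      \<partial>std_normal_distribution \<partial>uniform_count_measure {1..n} \<partial>data_law n x scan)"
proof -
  let ?f = "\<lambda>h. G (restrict h {0..<k}) (h k)"
  have f: "?f \<in> borel_measurable (history_space n (Suc k))"
  proof -
    have "(\<lambda>D. (restrict D {0..<k}, D k)) \<in> history_space n (Suc k) \<rightarrow>\<^sub>M history_space n k \<Otimes>\<^sub>M step_space n"
      unfolding history_space_def
      by (intro measurable_Pair measurable_restrict_subset measurable_step) auto
    from measurable_compose[OF this G] show ?thesis by simp
  qed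
  have "(\<integral>\<^sup>+D. G D (D k) \<partial>data_law n x scan) = (\<integral>\<^sup>+D. ?f (restrict D {0..<Suc k}) \<partial>data_law n x scan)"
    by (intro nn_integral_cong) (simp add: local inf.absorb2)
  also have "\<dots> = (\<integral>\<^sup>+D. \<integral>\<^sup>+y. ?f ((restrict D {0..<k})(k := y))
      \<partial>step_law n x scan k (restrict D {0..<k}) \<partial>data_law n x scan)"
    by (rule nn_integral_data_law_Suc[OF sensing_strategy_scan f])
  also have "\<dots> = (\<integral>\<^sup>+D. \<integral>\<^sup>+y. G (restrict D {0..<k}) y
      \<partial>step_law n x scan k (restrict D {0..<k}) \<partial>data_law n x scan)"
  proof (intro nn_integral_cong)
    fix D :: "nat \<Rightarrow> real \<times> nat \<times> real" and y
    have "restrict ((restrict D {0..<k})(k := y)) {0..<k} = restrict D {0..<k}"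
      by (auto simp: restrict_def)
    then show "?f ((restrict D {0..<k})(k := y)) = G (restrict D {0..<k}) y"
      by simp
  qed
  also have "\<dots> = (\<integral>\<^sup>+D. \<integral>\<^sup>+i. \<integral>\<^sup>+w. G D (response x (next_entry k D i) (next_gamma k D) w,
        next_entry k D i, next_gamma k D)
      \<partial>std_normal_distribution \<partial>uniform_count_measure {1..n} \<partial>data_law n x scan)"
  proof (intro nn_integral_cong)
    fix D assume "D \<in> space (data_law n x scan)"
    then have "D \<in> space (data_space n)"
      using sets_eq_imp_space_eq[OF sets_data_law[OF sensing_strategy_scan]] by simp
    then have h: "restrict D {0..<k} \<in> space (history_space n k)"
      unfolding data_space_def history_space_def
      by (rule measurable_space[OF measurable_restrict_subset, rotated]) simp
    have "G (restrict D {0..<k}) \<in> borel_measurable (step_space n)"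
      using measurable_Pair2[OF G h] by simp
    from nn_integral_step_law_scan[OF h this]
    show "(\<integral>\<^sup>+y. G (restrict D {0..<k}) y \<partial>step_law n x scan k (restrict D {0..<k})) =
      (\<integral>\<^sup>+i. \<integral>\<^sup>+w. G D (response x (next_entry k D i) (next_gamma k D) w,
        next_entry k D i, next_gamma k D) \<partial>std_normal_distribution \<partial>uniform_count_measure {1..n})"
      by (simp add: local next_gamma_restrict next_entry_restrict)
  qed
  finally show ?thesis .
qed

end

section \<open>Indicators and measurable step events\<close>

lemma nn_integral_if_pred:
  assumes "Measurable.pred M P"
  shows "(\<integral>\<^sup>+x. (if P x then 1 else 0) \<partial>M) = emeasure M {x \<in> space M. P x}"
proof -
  have "(\<integral>\<^sup>+x. (if P x then 1 else 0) \<partial>M) = (\<integral>\<^sup>+x. indicator {x \<in> space M. P x} x \<partial>M)"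
    by (intro nn_integral_cong) auto
  also have "\<dots> = emeasure M {x \<in> space M. P x}"
    using assms by (intro nn_integral_indicator) (simp add: pred_def)
  finally show ?thesis .
qed

lemma measurable_entry_pred: "Measurable.pred (step_space n) (\<lambda>y. Q (fst (snd y)))"
  by (rule measurable_compose[OF measurable_entry_step_space]) simp

lemma measurable_gamma_pred: "Measurable.pred (step_space n) (\<lambda>y. snd (snd y) \<noteq> 0)"
  by (rule measurable_compose[OF measurable_snd_step_space, of "\<lambda>z. z \<noteq> 0"]) simp

lemma measurable_value_pred: "Measurable.pred (step_space n) (\<lambda>y. fst y > c)"
  by (rule measurable_compose[OF measurable_fst_step_space, of "\<lambda>z. z > c"]) simp

lemma measurable_pair_pred:
  assumes "Measurable.pred M R" "Measurable.pred N E"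
  shows "Measurable.pred (M \<Otimes>\<^sub>M N) (\<lambda>(h, y). R h \<and> E y)"
proof -
  note [measurable] = measurable_compose[OF measurable_fst assms(1)] measurable_compose[OF measurable_snd assms(2)]
  show ?thesis unfolding case_prod_beta' by measurable
qed

lemma measurable_if_ennreal:
  assumes "Measurable.pred M P"
  shows "(\<lambda>x. if P x then c else 0 :: ennreal) \<in> borel_measurable M"
  using assms by (intro measurable_If) (simp_all add: pred_def)

context sequential_scan
begin

lemma space_data_law: "space (data_law n x scan) = space (data_space n)"
  by (rule sets_eq_imp_space_eq[OF sets_data_law[OF sensing_strategy_scan]])

lemma measurable_data_law: "(f \<in> data_law n x scan \<rightarrow>\<^sub>M L) = (f \<in> data_space n \<rightarrow>\<^sub>M L)"
  by (rule measurable_cong_sets[OF sets_data_law[OF sensing_strategy_scan] refl, THEN arg_cong])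

lemma prob_space_scan: "prob_space (data_law n x scan)"
  by (rule prob_space_data_law[OF sensing_strategy_scan])

section \<open>One-step probability bounds\<close>

text \<open>An event of the filtration at time \<open>k\<close>, encoded as a predicate on whole
  sequences that ignores all coordinates from \<open>k\<close> on.\<close>

definition history_event :: "nat \<Rightarrow> ((nat \<Rightarrow> real \<times> nat \<times> real) \<Rightarrow> bool) \<Rightarrow> bool" where
  "history_event k R \<longleftrightarrow> Measurable.pred (history_space n k) R \<and> (\<forall>D. R (restrict D {0..<k}) = R D)"

lemma measurable_history_event_step:
  assumes "history_event k R" "Measurable.pred (step_space n) E"
  shows "Measurable.pred (data_space n) (\<lambda>D. R D \<and> E (D k))"
  using assms unfolding history_event_def
  by (intro measurable_history_step[where G = "\<lambda>h y. R h \<and> E y"] measurable_pair_pred) auto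

text \<open>Conditionally on the past and the draw only the noise is random. An inequality for the
  noise alone, uniform in past and draw, therefore integrates to one between probabilities.\<close>

lemma prob_scan_step_le:
  assumes R: "history_event k R"
    and E1: "Measurable.pred (step_space n) E1" and E2: "Measurable.pred (step_space n) E2"
    and c: "c \<ge> 0"
    and le: "\<And>D i. (\<integral>\<^sup>+w. (if E1 (response x (next_entry k D i) (next_gamma k D) w,
          next_entry k D i, next_gamma k D) then 1 else 0) \<partial>std_normal_distribution) \<le>
      (\<integral>\<^sup>+w. (if E2 (response x (next_entry k D i) (next_gamma k D) w,
          next_entry k D i, next_gamma k D) then ennreal c else 0) \<partial>std_normal_distribution)"
  shows "\<P>(D in data_law n x scan. R D \<and> E1 (D k)) \<le> c * \<P>(D in data_law n x scan. R D \<and> E2 (D k))"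
proof -
  let ?M = "data_law n x scan"
  interpret prob_space ?M by (rule prob_space_scan)
  have G: "(\<lambda>(h, y). if R h \<and> E y then a else 0 :: ennreal) \<in>
      borel_measurable (history_space n k \<Otimes>\<^sub>M step_space n)"
    if "Measurable.pred (step_space n) E" for E and a
  proof -
    have "Measurable.pred (history_space n k \<Otimes>\<^sub>M step_space n) (\<lambda>(h, y). R h \<and> E y)"
      using R that by (intro measurable_pair_pred) (simp_all add: history_event_def)
    from measurable_if_ennreal[OF this, of a] show ?thesis
      by (simp add: case_prod_beta')
  qed
  have local: "R (restrict D {0..<k}) = R D" for D
    using R by (simp add: history_event_def)
  have meas: "Measurable.pred ?M (\<lambda>D. R D \<and> E (D k))" if "Measurable.pred (step_space n) E" for E
    unfolding measurable_data_law using R that by (rule measurable_history_event_step)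
  have "emeasure ?M {D \<in> space ?M. R D \<and> E1 (D k)} = (\<integral>\<^sup>+D. (if R D \<and> E1 (D k) then 1 else 0) \<partial>?M)"
    by (rule nn_integral_if_pred[symmetric, OF meas[OF E1]])
  also have "\<dots> \<le> (\<integral>\<^sup>+D. (if R D \<and> E2 (D k) then ennreal c else 0) \<partial>?M)"
    unfolding nn_integral_scan_step[where G = "\<lambda>h y. if R h \<and> E1 y then 1 else 0", OF G[OF E1], unfolded local, OF refl]
      nn_integral_scan_step[where G = "\<lambda>h y. if R h \<and> E2 y then ennreal c else 0", OF G[OF E2], unfolded local, OF refl]
  proof (rule nn_integral_mono, rule nn_integral_mono, goal_cases)
    case (1 D i)
    show ?case using le[of D i] by (cases "R D") simp_all
  qed
  also have "\<dots> = (\<integral>\<^sup>+D. ennreal c * (if R D \<and> E2 (D k) then 1 else 0) \<partial>?M)"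
    by (intro nn_integral_cong) simp
  also have "\<dots> = ennreal c * emeasure ?M {D \<in> space ?M. R D \<and> E2 (D k)}"
    by (subst nn_integral_cmult) (auto intro!: measurable_if_ennreal meas E2 nn_integral_if_pred arg_cong[where f = "times _"])
  finally show ?thesis
    using c by (simp add: emeasure_eq_measure ennreal_mult[symmetric])
qed

lemma measurable_wrong_decision_pred:
  "Measurable.pred (step_space n) (\<lambda>y. Q (fst (snd y)) \<and> snd (snd y) \<noteq> 0 \<and>
      (fst y > \<mu> / 2 \<longleftrightarrow> fst (snd y) \<notin> S))"
proof -
  have "Measurable.pred L (\<lambda>y. A y \<and> B y \<and> (V y \<longleftrightarrow> \<not> E y))"
    if [measurable]: "Measurable.pred L A" "Measurable.pred L B" "Measurable.pred L V" "Measurable.pred L E"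
    for A B V E and L :: "(real \<times> nat \<times> real) measure"
    by measurable
  from this[OF measurable_entry_pred measurable_gamma_pred measurable_value_pred measurable_entry_pred]
  show ?thesis .
qed

text \<open>The equivalence describes a wrong decision: a pass outside the support or a stop on it.
  Either way the noise must move the response by at least \<open>\<mu> / 2\<close> in one direction,
  so a single tail bound serves both. \<open>Q\<close> later selects the entries on or off the
  support.\<close>

lemma prob_wrong_decision_le:
  assumes R: "history_event k R"
  shows "\<P>(D in data_law n (signal \<mu> S) scan. R D \<and> (Q (fst (snd (D k))) \<and> snd (snd (D k)) \<noteq> 0 \<and>
        (fst (D k) > \<mu> / 2 \<longleftrightarrow> fst (snd (D k)) \<notin> S)))
    \<le> (1 / 4) ^ Suc (k mod J) *
       \<P>(D in data_law n (signal \<mu> S) scan. R D \<and> (Q (fst (snd (D k))) \<and> snd (snd (D k)) \<noteq> 0))"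
proof (rule prob_scan_step_le[OF R, where ?E1.0 = "\<lambda>y. Q (fst (snd y)) \<and> snd (snd y) \<noteq> 0 \<and> (fst y > \<mu> / 2 \<longleftrightarrow> fst (snd y) \<notin> S)"
      and ?E2.0 = "\<lambda>y. Q (fst (snd y)) \<and> snd (snd y) \<noteq> 0"])
  show "Measurable.pred (step_space n) (\<lambda>y. Q (fst (snd y)) \<and> snd (snd y) \<noteq> 0)"
    using measurable_entry_pred[where Q = Q and n = n] measurable_gamma_pred[where n = n] by (rule pred_intros_logic)
  show "Measurable.pred (step_space n) (\<lambda>y. Q (fst (snd y)) \<and> snd (snd y) \<noteq> 0 \<and>
      (fst y > \<mu> / 2 \<longleftrightarrow> fst (snd y) \<notin> S))"
    by (rule measurable_wrong_decision_pred)
next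
  fix D :: "nat \<Rightarrow> real \<times> nat \<times> real" and i
  let ?a = "next_entry k D i" and ?\<gamma> = "next_gamma k D" and ?N = std_normal_distribution
  let ?W = "\<lambda>w. response (signal \<mu> S) ?a ?\<gamma> w > \<mu> / 2 \<longleftrightarrow> ?a \<notin> S"
  interpret N: prob_space ?N by (rule prob_space_normal_density) simp
  have "(\<integral>\<^sup>+w. (if ?W w then 1 else 0) \<partial>?N) \<le> ennreal ((1 / 4) ^ Suc (k mod J))" if \<gamma>: "?\<gamma> \<noteq> 0"
  proof -
    \<comment> \<open>The harmful direction of the noise: downwards on the support, upwards off it.
      After scaling by the precision the distance to the threshold is \<open>c\<close>.\<close>
    define \<sigma> :: real where "\<sigma> = (if ?a \<in> S then - 1 else 1)"
    define c where "c = ?\<gamma> * \<mu> / 2"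
    have \<gamma>_pos: "?\<gamma> > 0" using \<gamma> next_gamma_nonneg[of k D] by simp
    have "?\<gamma>\<^sup>2 = round_precision (k mod J)"
      using next_gamma_nonzero[OF \<gamma>] round_precision_pos[of "k mod J"] by simp
    then have "c\<^sup>2 = round_precision (k mod J) * \<mu>\<^sup>2 / 4"
      by (simp add: c_def power_mult_distrib power_divide)
    also have "\<dots> = 4 * real (Suc (k mod J))"
      using \<mu> by (simp add: round_precision_def)
    finally have c2: "- c\<^sup>2 / 2 = real (Suc (k mod J)) * (- 2)" by simp
    \<comment> \<open>The constant 16 in \<open>round_precision\<close> was chosen to make the tail
      a power of \<open>exp (- 2)\<close>, and \<open>exp 1 \<ge> 2\<close> turns this into a power
      of \<open>1 / 4\<close>.\<close>
    have "(4::real) \<le> exp 2"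
      using exp_ge_add_one_self[of "1::real"] mult_mono[of 2 "exp (1::real)" 2 "exp 1"] 
      by (simp add: exp_add[symmetric] mult_exp_exp)
    then have e: "exp (- c\<^sup>2 / 2) \<le> (1 / 4) ^ Suc (k mod J)"
      unfolding c2 exp_of_nat_mult by (intro power_mono) (simp_all add: exp_minus field_simps)
    have W: "c \<le> \<sigma> * w" if "?W w" for w
      using that \<gamma>_pos by (auto simp: response_def signal_def \<sigma>_def c_def field_simps split: if_splits)
    have "(\<integral>\<^sup>+w. (if ?W w then 1 else 0) \<partial>?N) \<le> (\<integral>\<^sup>+w. (if c \<le> \<sigma> * w then 1 else 0) \<partial>?N)"
      using W by (intro nn_integral_mono) auto
    also have "\<dots> = emeasure ?N {w. c \<le> \<sigma> * w}"
      by (subst nn_integral_if_pred) auto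
    also have "\<dots> \<le> ennreal (exp (- c\<^sup>2 / 2))"
      using \<gamma>_pos \<mu> by (intro emeasure_std_normal_tail) (auto simp: c_def \<sigma>_def)
    also have "\<dots> \<le> ennreal ((1 / 4) ^ Suc (k mod J))"
      by (rule ennreal_leI[OF e])
    finally show ?thesis .
  qed
  moreover have "(\<integral>\<^sup>+w. ennreal ((1 / 4) ^ Suc (k mod J)) \<partial>?N) = ennreal ((1 / 4) ^ Suc (k mod J))"
    using N.emeasure_space_1 by simp
  ultimately show "(\<integral>\<^sup>+w. (if Q (fst (snd (response (signal \<mu> S) ?a ?\<gamma> w, ?a, ?\<gamma>))) \<and>
        snd (snd (response (signal \<mu> S) ?a ?\<gamma> w, ?a, ?\<gamma>)) \<noteq> 0 \<and>
        (fst (response (signal \<mu> S) ?a ?\<gamma> w, ?a, ?\<gamma>) > \<mu> / 2 \<longleftrightarrow>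
         fst (snd (response (signal \<mu> S) ?a ?\<gamma> w, ?a, ?\<gamma>)) \<notin> S) then 1 else 0) \<partial>?N)
    \<le> (\<integral>\<^sup>+w. (if Q (fst (snd (response (signal \<mu> S) ?a ?\<gamma> w, ?a, ?\<gamma>))) \<and>
        snd (snd (response (signal \<mu> S) ?a ?\<gamma> w, ?a, ?\<gamma>)) \<noteq> 0
        then ennreal ((1 / 4) ^ Suc (k mod J)) else 0) \<partial>?N)"
    by (cases "Q ?a \<and> ?\<gamma> \<noteq> 0") (auto simp del: power_Suc)
qed simp

text \<open>At the start of a block the entry is the fresh uniform draw, which is independent of the
  past event \<open>R\<close>.\<close>

lemma prob_draw:
  assumes R: "history_event k R" and k: "k mod J = 0" and S: "S \<subseteq> {1..n}"
  shows "\<P>(D in data_law n x scan. R D \<and> fst (snd (D k)) \<in> S) =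
    real (card S) / real n * \<P>(D in data_law n x scan. R D)"
proof -
  let ?M = "data_law n x scan" and ?N = std_normal_distribution and ?U = "uniform_count_measure {1..n}"
  interpret prob_space ?M by (rule prob_space_scan)
  interpret N: prob_space ?N by (rule prob_space_normal_density) simp
  have E: "Measurable.pred (step_space n) (\<lambda>y. fst (snd y) \<in> S)"
    by (rule measurable_entry_pred)
  have G: "(\<lambda>(h, y). if R h \<and> fst (snd y) \<in> S then 1 else 0 :: ennreal) \<in>
      borel_measurable (history_space n k \<Otimes>\<^sub>M step_space n)"
    using measurable_if_ennreal[OF measurable_pair_pred[OF _ E, where R = R and M = "history_space n k"]] R
    by (simp add: history_event_def case_prod_beta')
  have local: "R (restrict D {0..<k}) = R D" for D
    using R by (simp add: history_event_def)
  have meas: "Measurable.pred ?M (\<lambda>D. R D \<and> fst (snd (D k)) \<in> S)"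
    unfolding measurable_data_law using R E by (rule measurable_history_event_step)
  have measR: "Measurable.pred ?M R"
    unfolding measurable_data_law using measurable_history_event_step[OF R, of "\<lambda>_. True"] by simp
  have U: "(\<integral>\<^sup>+i. (if i \<in> S then 1 else 0) \<partial>?U) = ennreal (real (card S) / real n)"
  proof -
    have "(\<integral>\<^sup>+i. (if i \<in> S then 1 else 0) \<partial>?U) = emeasure ?U {i \<in> space ?U. i \<in> S}"
      by (rule nn_integral_if_pred) (simp add: pred_def)
    also have "{i \<in> space ?U. i \<in> S} = S"
      using S by (auto simp: space_uniform_count_measure)
    also have "emeasure ?U S = ennreal (real (card S) / real n)"
      using S by (subst emeasure_uniform_count_measure) auto
    finally show ?thesis .
  qed
  have "emeasure ?M {D \<in> space ?M. R D \<and> fst (snd (D k)) \<in> S} =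
      (\<integral>\<^sup>+D. (if R D \<and> fst (snd (D k)) \<in> S then 1 else 0) \<partial>?M)"
    by (rule nn_integral_if_pred[symmetric, OF meas])
  also have "\<dots> = (\<integral>\<^sup>+D. \<integral>\<^sup>+i. (if R D \<and> i \<in> S then 1 else 0) \<partial>?U \<partial>?M)"
    unfolding nn_integral_scan_step[where G = "\<lambda>h y. if R h \<and> fst (snd y) \<in> S then 1 else 0", OF G, unfolded local, OF refl]
    using N.emeasure_space_1 k by (simp add: next_entry_def)
  also have "\<dots> = (\<integral>\<^sup>+D. ennreal (real (card S) / real n) * (if R D then 1 else 0) \<partial>?M)"
    using U by (intro nn_integral_cong) simp
  also have "\<dots> = ennreal (real (card S) / real n) * emeasure ?M {D \<in> space ?M. R D}"
    by (subst nn_integral_cmult) (auto intro!: measurable_if_ennreal measR nn_integral_if_pred arg_cong[where f = "times _"])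
  finally show ?thesis
    by (simp add: emeasure_eq_measure ennreal_mult[symmetric])
qed

section \<open>Almost sure rules of the scan\<close>

text \<open>Given the history, the precision is deterministic, and so is the entry inside a block.
  Integrating out step \<open>k\<close> hence gives a violation of the rule probability
  zero.\<close>

lemma AE_scan:
  "AE D in data_law n x scan. \<forall>k. snd (snd (D k)) = next_gamma k D \<and>
     (k mod J \<noteq> 0 \<longrightarrow> fst (snd (D k)) = fst (snd (D (k - 1))))"
  unfolding AE_all_countable
proof
  fix k
  let ?M = "data_law n x scan"
  \<comment> \<open>The draw \<open>1\<close> is a placeholder: entries are compared only where
    \<open>next_entry\<close> ignores the draw.\<close>
  let ?P = "\<lambda>h y. snd (snd y) = next_gamma k h \<and> (k mod J \<noteq> 0 \<longrightarrow> fst (snd y) = next_entry k h 1)"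
  let ?H = "history_space n k \<Otimes>\<^sub>M step_space n"
  have eq: "Measurable.pred ?H (\<lambda>p. f p = g p)"
    if "f \<in> borel_measurable ?H" "g \<in> borel_measurable ?H" for f g :: "_ \<Rightarrow> real"
    using borel_measurable_eq[OF that] by (simp add: pred_def)
  have 1: "Measurable.pred ?H (\<lambda>p. snd (snd (snd p)) = next_gamma k (fst p))"
    unfolding history_space_def
    by (intro eq[unfolded history_space_def] measurable_compose[OF measurable_snd measurable_snd_step_space]
        measurable_compose[OF measurable_fst measurable_next_gamma]) simp
  have entry: "(\<lambda>h. next_entry k h 1) \<in> history_space n k \<rightarrow>\<^sub>M count_space {1..n}"
    using measurable_Pair1[OF measurable_next_entry[OF order_refl, of k], of 1] n
    by (simp add: history_space_def)
  have "Measurable.pred ?H (\<lambda>p. real (fst (snd (snd p))) = real (next_entry k (fst p) 1))"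
    by (intro eq measurable_compose[OF measurable_compose[OF measurable_snd measurable_entry_step_space]]
        measurable_compose[OF measurable_compose[OF measurable_fst entry]]) simp_all
  then have 2: "Measurable.pred ?H (\<lambda>p. fst (snd (snd p)) = next_entry k (fst p) 1)"
    by simp
  have P: "Measurable.pred ?H (\<lambda>(h, y). \<not> ?P h y)"
  proof -
    have "Measurable.pred L (\<lambda>p. \<not> (A p \<and> (k mod J \<noteq> 0 \<longrightarrow> B p)))"
      if [measurable]: "Measurable.pred L A" "Measurable.pred L B"
      for A B and L :: "((nat \<Rightarrow> real \<times> nat \<times> real) \<times> real \<times> nat \<times> real) measure"
      by measurable
    from this[OF 1 2] show ?thesis by (simp add: case_prod_beta')
  qed
  have local: "?P (restrict D {0..<k}) y = ?P D y" for D y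
    by (simp add: next_gamma_restrict next_entry_restrict)
  have G: "(\<lambda>(h, y). if \<not> ?P h y then 1 else 0 :: ennreal) \<in> borel_measurable ?H"
    using measurable_if_ennreal[OF P] by (simp add: case_prod_beta')
  have meas: "Measurable.pred ?M (\<lambda>D. \<not> ?P D (D k))"
    unfolding measurable_data_law by (rule measurable_history_step[OF P]) (simp only: local)
  have "emeasure ?M {D \<in> space ?M. \<not> ?P D (D k)} = (\<integral>\<^sup>+D. (if \<not> ?P D (D k) then 1 else 0) \<partial>?M)"
    by (rule nn_integral_if_pred[symmetric, OF meas])
  also have "\<dots> = 0"
    unfolding nn_integral_scan_step[where G = "\<lambda>h y. if \<not> ?P h y then 1 else 0", OF G, unfolded local, OF refl]
    by (simp add: next_entry_def)
  finally have "AE D in ?M. ?P D (D k)"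
    using meas by (subst AE_iff_measurable[OF _ refl]) (simp_all add: pred_def)
  then show "AE D in ?M. snd (snd (D k)) = next_gamma k D \<and>
     (k mod J \<noteq> 0 \<longrightarrow> fst (snd (D k)) = fst (snd (D (k - 1))))"
    by (simp add: next_entry_def cong: conj_cong imp_cong)
qed

end

section \<open>Elementary sums\<close>

lemma sum_Suc_quarter_power: "(\<Sum>j<J. (real j + 1) * (1 / 4) ^ j) \<le> 2"
proof -
  \<comment> \<open>The series of \<open>1 / (1 - x)\<^sup>2\<close> at \<open>x = 1 / 4\<close> has
    value \<open>16 / 9\<close>; the exact remainder makes the induction go through.\<close>
  have "(\<Sum>j<J. (real j + 1) * (1 / 4) ^ j) = 16 / 9 - (4 / 3 * real J + 16 / 9) * (1 / 4) ^ J"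
  proof (induction J)
    case (Suc J)
    have "16 / 9 - (4 / 3 * a + 16 / 9) * y + (a + 1) * y = 16 / 9 - (4 / 3 * (a + 1) + 16 / 9) * (1 / 4 * y)"
      for a y :: real
      by (simp add: field_simps)
    then show ?case
      by (simp only: sum.lessThan_Suc Suc power_Suc of_nat_Suc add.commute[of 1])
  qed simp
  also have "\<dots> \<le> 2"
  proof -
    have "0 \<le> (4 / 3 * real J + 16 / 9) * (1 / 4) ^ J" by simp
    then show ?thesis by linarith
  qed
  finally show ?thesis .
qed

text \<open>This will bound the probability that some round decides wrongly about an entry of the
  support, so such an entry passes its block with probability at least \<open>1 / 2\<close> unless
  the budget interferes.\<close>

lemma sum_quarter_power_Suc: "(\<Sum>j<J. (1 / 4 :: real) ^ Suc j) \<le> 1 / 2"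
proof -
  have "(\<Sum>j<J. (1 / 4 :: real) ^ Suc j) = 1 / 3 - 1 / 3 * (1 / 4) ^ J"
    by (induction J) simp_all
  also have "\<dots> \<le> 1 / 2" using zero_le_power[of "1 / 4 :: real" J] by linarith
  finally show ?thesis .
qed

lemma sum_blocks:
  fixes f :: "nat \<Rightarrow> real"
  shows "(\<Sum>k<T * J. f k) = (\<Sum>t<T. \<Sum>j<J. f (t * J + j))"
proof -
  have "(\<Sum>k<T * J. f k) = (\<Sum>t<T. sum f {t * J..<t * J + J})"
    by (rule sum.nat_group[symmetric])
  also have "\<dots> = (\<Sum>t<T. \<Sum>j<J. f (t * J + j))"
  proof (rule sum.cong[OF refl])
    show "sum f {t * J..<t * J + J} = (\<Sum>j<J. f (t * J + j))" for t
      using sum.shift_bounds_nat_ivl[of f 0 "t * J" J] by (simp add: add.commute atLeast0LessThan)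
  qed
  finally show ?thesis .
qed

context sequential_scan
begin

section \<open>Pathwise consequences and the budget\<close>

text \<open>The null set is removed once and for all; facts about single paths are deduced from
  these two rules.\<close>

definition consistent :: "(nat \<Rightarrow> real \<times> nat \<times> real) \<Rightarrow> bool" where
  "consistent D \<longleftrightarrow> (\<forall>k. snd (snd (D k)) = next_gamma k D \<and>
     (k mod J \<noteq> 0 \<longrightarrow> fst (snd (D k)) = fst (snd (D (k - 1)))))"

lemma AE_consistent: "AE D in data_law n x scan. consistent D"
  using AE_scan by (simp add: consistent_def)

lemma consistent_precision:
  assumes "consistent D"
  shows "precision D k = (if snd (snd (D k)) \<noteq> 0 then round_precision (k mod J) else 0)"
proof -
  have "snd (snd (D k)) = next_gamma k D" using assms by (simp add: consistent_def)
  then show ?thesis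
    using next_gamma_nonzero[of k D] round_precision_pos[of "k mod J"]
    by (auto simp: precision_def)
qed

text \<open>The budget is checked before each measurement, and silent steps cost nothing.\<close>

lemma consistent_spent_le:
  assumes D: "consistent D"
  shows "spent k D \<le> m"
proof (induction k)
  case 0
  then show ?case using m by (simp add: spent_def)
next
  case (Suc k)
  have "snd (snd (D k)) = next_gamma k D" using D by (simp add: consistent_def)
  then show ?case
    using Suc consistent_precision[OF D, of k]
    by (auto simp: spent_Suc next_gamma_def split: if_splits)
qed

lemma consistent_active:
  assumes "consistent D" "k mod J \<noteq> 0" "snd (snd (D k)) \<noteq> 0"
  shows "passed (D (k - 1))"
  using assms by (auto simp: consistent_def next_gamma_def split: if_splits)

lemma consistent_entry:
  assumes "consistent D" "j < J"
  shows "fst (snd (D (t * J + j))) = fst (snd (D (t * J)))"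
  using assms(2)
proof (induction j)
  case (Suc j)
  have "(t * J + Suc j) mod J \<noteq> 0" using Suc.prems by simp
  then have "fst (snd (D (t * J + Suc j))) = fst (snd (D (t * J + Suc j - 1)))"
    using assms(1) unfolding consistent_def by blast
  then show ?case using Suc by simp
qed simp

text \<open>The last round is the most expensive one and \<open>spent\<close> is monotone. If a last
  round still fits at the later time \<open>l\<close>, the budget check cannot have failed at time
  \<open>k\<close>, so only the previous response decides.\<close>

lemma consistent_measured:
  assumes D: "consistent D" and k: "k < T * J" "k \<le> l"
    and pass: "k mod J = 0 \<or> passed (D (k - 1))"
    and funded: "spent l D + round_precision (J - 1) \<le> m"
  shows "snd (snd (D k)) \<noteq> 0"
proof -
  have "round_precision (k mod J) \<le> round_precision (J - 1)"
    using J by (intro round_precision_mono) (metis One_nat_def Suc_le_eq Suc_pred mod_less_divisor less_Suc_eq_le)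
  then have "spent k D + round_precision (k mod J) \<le> m"
    using funded spent_mono[OF k(2), of D] by simp
  then have "next_gamma k D = sqrt (round_precision (k mod J))"
    using k pass by (simp add: next_gamma_def)
  then show ?thesis
    using D round_precision_pos[of "k mod J"] by (simp add: consistent_def)
qed

lemma within_budget_scan: "within_budget n \<mu> m scan"
  unfolding within_budget_def support_law_def
proof (intro allI impI)
  fix S
  show "AE D in data_law n (signal \<mu> S) scan. (\<Sum>k. ennreal (precision D k)) \<le> ennreal m"
    using AE_consistent
  proof eventually_elim
    case (elim D)
    have "(\<Sum>k<N. ennreal (precision D k)) \<le> ennreal m" for N
      using consistent_spent_le[OF elim, of N]
      by (simp add: sum_ennreal precision_nonneg spent_def ennreal_leI)
    then show ?case by (intro suminf_le_const) auto
  qed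
qed

section \<open>Past events as measurable sets\<close>

lemma history_event_True: "history_event k (\<lambda>_. True)"
  by (simp add: history_event_def)

lemma history_event_mono:
  assumes R: "history_event k R" and "k \<le> l"
  shows "history_event l R"
proof -
  have pred: "Measurable.pred (history_space n k) R" and local: "R (restrict D {0..<k}) = R D" for D
    using R by (simp_all add: history_event_def)
  have "(\<lambda>h. restrict h {0..<k}) \<in> history_space n l \<rightarrow>\<^sub>M history_space n k"
    unfolding history_space_def using \<open>k \<le> l\<close> by (intro measurable_restrict_subset) auto
  from measurable_compose[OF this pred] have "Measurable.pred (history_space n l) R"
    by (simp only: local)
  moreover have "R (restrict D {0..<l}) = R D" for D
  proof -
    have "restrict (restrict D {0..<l}) {0..<k} = restrict D {0..<k}"
      using \<open>k \<le> l\<close> by (simp add: inf.absorb2)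
    then show ?thesis using local[of "restrict D {0..<l}"] local[of D] by simp
  qed
  ultimately show ?thesis unfolding history_event_def by blast
qed

lemma sets_history_event_step:
  assumes "history_event k R" "Measurable.pred (step_space n) E"
  shows "{D \<in> space (data_law n x scan). R D \<and> E (D k)} \<in> sets (data_law n x scan)"
  using measurable_history_event_step[OF assms] sets_data_law[OF sensing_strategy_scan, of x]
  by (simp add: pred_def space_data_law)

lemma sets_step:
  assumes "Measurable.pred (step_space n) E"
  shows "{D \<in> space (data_law n x scan). E (D k)} \<in> sets (data_law n x scan)"
  using sets_history_event_step[OF history_event_True assms] by simp

lemma sets_history_event:
  assumes "history_event k R"
  shows "{D \<in> space (data_law n x scan). R D} \<in> sets (data_law n x scan)"
  using sets_history_event_step[OF assms, of "\<lambda>_. True"] by simp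

lemma measurable_gamma_entry_pred:
  "Measurable.pred (step_space n) (\<lambda>y. snd (snd y) \<noteq> 0 \<and> Q (fst (snd y)))"
  using measurable_gamma_pred measurable_entry_pred by (rule pred_intros_logic)

lemma measurable_passed_entry_pred:
  "Measurable.pred (step_space n) (\<lambda>y. passed y \<and> Q (fst (snd y)))"
  using measurable_passed measurable_entry_pred by (rule pred_intros_logic)

section \<open>Expected precision\<close>

lemma prob_passed_null_le:
  assumes j: "j < J"
  shows "\<P>(D in data_law n (signal \<mu> S) scan. passed (D (t * J + j)) \<and> fst (snd (D (t * J + j))) \<notin> S)
    \<le> (1 / 4) ^ Suc j *
      \<P>(D in data_law n (signal \<mu> S) scan. snd (snd (D (t * J + j))) \<noteq> 0 \<and> fst (snd (D (t * J + j))) \<notin> S)"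
proof -
  have "passed y \<and> fst (snd y) \<notin> S \<longleftrightarrow> fst (snd y) \<notin> S \<and> snd (snd y) \<noteq> 0 \<and> (fst y > \<mu> / 2 \<longleftrightarrow> fst (snd y) \<notin> S)" for y
    by (auto simp: passed_def)
  then show ?thesis
    using prob_wrong_decision_le[OF history_event_True, where k = "t * J + j" and S = S and Q = "\<lambda>a. a \<notin> S"] j
    by (simp add: conj_commute cong: conj_cong)
qed

text \<open>Outside the support, a round after the first is reached only through a wrong pass in the
  round before.\<close>

lemma prob_measured_null_le:
  assumes "j < J"
  shows "\<P>(D in data_law n (signal \<mu> S) scan. snd (snd (D (t * J + j))) \<noteq> 0 \<and> fst (snd (D (t * J + j))) \<notin> S)
    \<le> (1 / 4) ^ j"
  using assms
proof (induction j)
  case 0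
  interpret prob_space "data_law n (signal \<mu> S) scan" by (rule prob_space_scan)
  show ?case by simp
next
  case (Suc j)
  let ?M = "data_law n (signal \<mu> S) scan"
  interpret prob_space ?M by (rule prob_space_scan)
  have "\<P>(D in ?M. snd (snd (D (t * J + Suc j))) \<noteq> 0 \<and> fst (snd (D (t * J + Suc j))) \<notin> S)
    \<le> \<P>(D in ?M. passed (D (t * J + j)) \<and> fst (snd (D (t * J + j))) \<notin> S)"
  proof (rule finite_measure_mono_AE)
    show "AE D in ?M. D \<in> {D \<in> space ?M. snd (snd (D (t * J + Suc j))) \<noteq> 0 \<and> fst (snd (D (t * J + Suc j))) \<notin> S} \<longrightarrow>
      D \<in> {D \<in> space ?M. passed (D (t * J + j)) \<and> fst (snd (D (t * J + j))) \<notin> S}"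
      using AE_consistent
    proof eventually_elim
      case (elim D)
      have "(t * J + Suc j) mod J \<noteq> 0" using Suc.prems by simp
      from consistent_active[OF elim this] consistent_entry[OF elim, of j t] consistent_entry[OF elim, of "Suc j" t]
      show ?case using Suc.prems by simp
    qed
  qed (rule sets_step[OF measurable_passed_entry_pred])
  also have "\<dots> \<le> (1 / 4) ^ Suc j *
      \<P>(D in ?M. snd (snd (D (t * J + j))) \<noteq> 0 \<and> fst (snd (D (t * J + j))) \<notin> S)"
    using Suc.prems by (intro prob_passed_null_le) simp
  \<comment> \<open>The error of that single round suffices; the probability of having reached it is
    bounded by 1.\<close>
  also have "\<dots> \<le> (1 / 4) ^ Suc j * 1"
    by (intro mult_left_mono) simp_all
  finally show ?case by simp
qed

text \<open>The entry is almost surely constant within a block, so round \<open>j\<close> can be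
  replaced by the round of the draw.\<close>

lemma prob_draw_block:
  assumes R: "history_event (t * J) R" and j: "j < J" and S: "S \<subseteq> {1..n}"
  shows "\<P>(D in data_law n x scan. R D \<and> fst (snd (D (t * J + j))) \<in> S) =
    real (card S) / real n * \<P>(D in data_law n x scan. R D)"
proof -
  let ?M = "data_law n x scan"
  interpret prob_space ?M by (rule prob_space_scan)
  have E: "Measurable.pred (step_space n) (\<lambda>y. fst (snd y) \<in> S)"
    by (rule measurable_entry_pred)
  have "\<P>(D in ?M. R D \<and> fst (snd (D (t * J + j))) \<in> S) = \<P>(D in ?M. R D \<and> fst (snd (D (t * J))) \<in> S)"
  proof (rule finite_measure_eq_AE)
    show "AE D in ?M. (D \<in> {D \<in> space ?M. R D \<and> fst (snd (D (t * J + j))) \<in> S}) =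
      (D \<in> {D \<in> space ?M. R D \<and> fst (snd (D (t * J))) \<in> S})"
      using AE_consistent by eventually_elim (simp add: consistent_entry[OF _ j])
  qed (intro sets_history_event_step[OF _ E] history_event_mono[OF R]; simp)+
  also have "\<dots> = real (card S) / real n * \<P>(D in ?M. R D)"
    by (rule prob_draw[OF R _ S]) simp
  finally show ?thesis .
qed

text \<open>Entries outside the support rarely survive to round \<open>j\<close>. Entries of the
  support may go through every round, but are themselves rarely drawn.\<close>

lemma prob_measured_le:
  assumes j: "j < J" and S: "S \<subseteq> {1..n}"
  shows "\<P>(D in data_law n (signal \<mu> S) scan. snd (snd (D (t * J + j))) \<noteq> 0)
    \<le> (1 / 4) ^ j + real (card S) / real n"
proof -
  let ?M = "data_law n (signal \<mu> S) scan"
  let ?A = "{D \<in> space ?M. snd (snd (D (t * J + j))) \<noteq> 0 \<and> fst (snd (D (t * J + j))) \<notin> S}"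
  let ?B = "{D \<in> space ?M. fst (snd (D (t * J + j))) \<in> S}"
  interpret prob_space ?M by (rule prob_space_scan)
  have sets: "?A \<in> sets ?M" "?B \<in> sets ?M"
    by (rule sets_step[OF measurable_gamma_entry_pred], rule sets_step[OF measurable_entry_pred])
  have "\<P>(D in ?M. snd (snd (D (t * J + j))) \<noteq> 0) \<le> prob (?A \<union> ?B)"
    using sets by (intro finite_measure_mono) auto
  also have "\<dots> \<le> prob ?A + prob ?B"
    by (rule measure_Un_le[OF sets])
  also have "prob ?A \<le> (1 / 4) ^ j"
    by (rule prob_measured_null_le[OF j])
  also have "prob ?B = real (card S) / real n"
    using prob_draw_block[OF history_event_True j S, where t = t and x = "signal \<mu> S"] prob_space by simp
  finally show ?thesis by simp
qed

lemma borel_measurable_spent: "spent k \<in> borel_measurable (data_law n x scan)"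
  unfolding measurable_data_law data_space_def by (rule measurable_spent) simp

lemma borel_measurable_precision: "(\<lambda>D. precision D k) \<in> borel_measurable (data_law n x scan)"
  using borel_measurable_diff[OF borel_measurable_spent[of "Suc k" x] borel_measurable_spent[of k x]]
  by (simp add: spent_Suc)

text \<open>Off the support the geometric survival probabilities beat the linear growth of the
  precision, at a cost of order \<open>1 / \<mu>\<^sup>2\<close> per block. On the support a block
  may cost order \<open>J\<^sup>2 / \<mu>\<^sup>2\<close>, weighted by the probability of drawing
  such an entry.\<close>

lemma expectation_spent_le:
  assumes S: "S \<subseteq> {1..n}"
  shows "integrable (data_law n (signal \<mu> S) scan) (spent (T * J))" (is ?int)
    and "integral\<^sup>L (data_law n (signal \<mu> S) scan) (spent (T * J)) \<le>
      16 * real T / \<mu>\<^sup>2 * (2 + (real J)\<^sup>2 * (real (card S) / real n))" (is ?le)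
proof -
  let ?M = "data_law n (signal \<mu> S) scan" and ?r = "real (card S) / real n"
  interpret prob_space ?M by (rule prob_space_scan)
  have int: "integrable ?M (\<lambda>D. precision D k)" for k
  proof (rule integrable_const_bound[OF _ borel_measurable_precision])
    show "AE D in ?M. norm (precision D k) \<le> round_precision (k mod J)"
      using AE_consistent
      by eventually_elim (simp add: consistent_precision less_imp_le round_precision_pos)
  qed
  then show ?int
    unfolding spent_def by (intro Bochner_Integration.integrable_sum)
  have E: "expectation (\<lambda>D. precision D (t * J + j)) \<le> round_precision j * ((1 / 4) ^ j + ?r)" if j: "j < J" for t j
  proof -
    let ?A = "{D \<in> space ?M. snd (snd (D (t * J + j))) \<noteq> 0}"
    have A: "?A \<in> sets ?M" by (rule sets_step[OF measurable_gamma_pred])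
    have "expectation (\<lambda>D. precision D (t * J + j)) \<le> expectation (\<lambda>D. round_precision j * indicator ?A D)"
    proof (rule integral_mono_AE[OF int])
      show "AE D in ?M. precision D (t * J + j) \<le> round_precision j * indicator ?A D"
        using AE_consistent AE_space by eventually_elim (use j in \<open>simp add: consistent_precision\<close>)
    qed (use A in \<open>simp add: integrable_real_indicator emeasure_eq_measure\<close>)
    also have "\<dots> = round_precision j * prob ?A"
      using A by (simp add: sets.Int_space_eq2)
    also have "\<dots> \<le> round_precision j * ((1 / 4) ^ j + ?r)"
      using prob_measured_le[OF j S, of t] round_precision_pos[of j] by (intro mult_left_mono) simp_all
    finally show ?thesis .
  qed
  have "expectation (spent (T * J)) = (\<Sum>k<T * J. expectation (\<lambda>D. precision D k))"
    unfolding spent_def using int by (rule Bochner_Integration.integral_sum)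
  also have "\<dots> = (\<Sum>t<T. \<Sum>j<J. expectation (\<lambda>D. precision D (t * J + j)))"
    by (rule sum_blocks)
  also have "\<dots> \<le> (\<Sum>t<T. \<Sum>j<J. round_precision j * ((1 / 4) ^ j + ?r))"
    by (intro sum_mono E) simp
  also have "\<dots> = real T * (16 / \<mu>\<^sup>2 * ((\<Sum>j<J. (real j + 1) * (1 / 4) ^ j) + (\<Sum>j<J. real j + 1) * ?r))"
  proof -
    have "round_precision j * (a + b) = 16 / \<mu>\<^sup>2 * ((real j + 1) * a + (real j + 1) * b)" for j a b
      by (simp add: round_precision_def algebra_simps add_divide_distrib)
    then show ?thesis
      by (simp only: sum_distrib_left[symmetric] sum.distrib sum_distrib_right[symmetric] sum_constant card_lessThan)
        (simp only: distrib_left distrib_right mult_ac)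
  qed
  also have "\<dots> \<le> real T * (16 / \<mu>\<^sup>2 * (2 + (real J)\<^sup>2 * ?r))"
  proof -
    have "(\<Sum>j<J. real j + 1) \<le> (\<Sum>j<J. real J)"
      by (intro sum_mono) auto
    then show ?thesis
      using sum_Suc_quarter_power[of J] n
      by (intro mult_left_mono add_mono mult_right_mono) (simp_all add: power2_eq_square)
  qed
  also have "\<dots> = 16 * real T / \<mu>\<^sup>2 * (2 + (real J)\<^sup>2 * ?r)"
    by (rule trans[OF mult.assoc[symmetric]]) (simp only: times_divide_eq_right mult.commute)
  finally show ?le .
qed

section \<open>Detection block by block\<close>

text \<open>Failed detection is kept apart from a short budget: only paths that can still pay for
  the most expensive round are counted. The other paths are left to Markov's inequality.\<close>

definition undetected :: "nat \<Rightarrow> (nat \<Rightarrow> real \<times> nat \<times> real) \<Rightarrow> bool" where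
  "undetected t D \<longleftrightarrow> (\<forall>i<t. \<not> passed (D (i * J + (J - 1)))) \<and>
     spent (t * J) D + round_precision (J - 1) \<le> m"

lemma block_end_less: "i < t \<Longrightarrow> i * J + (J - 1) < t * J"
proof -
  assume "i < t"
  then have "(i + 1) * J \<le> t * J" by (intro mult_right_mono) auto
  then show ?thesis using J by simp
qed

lemma history_event_undetected: "history_event (t * J) (undetected t)"
proof -
  have p: "Measurable.pred (history_space n (t * J)) (\<lambda>h. passed (h (i * J + (J - 1))))" if "i < t" for i
    unfolding history_space_def using block_end_less[OF that]
    by (intro measurable_compose[OF measurable_step measurable_passed]) simp
  have s: "Measurable.pred (history_space n (t * J)) (\<lambda>h. spent (t * J) h + round_precision (J - 1) \<le> m)"
    unfolding history_space_def
    by (rule measurable_compose[OF measurable_spent, where g = "\<lambda>z. z + round_precision (J - 1) \<le> m"]) simp_all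
  have conj: "Measurable.pred L (\<lambda>h. (\<forall>i::nat. Q i h) \<and> F h)"
    if [measurable]: "\<And>i. Measurable.pred L (Q i)" "Measurable.pred L F"
    for L :: "(nat \<Rightarrow> real \<times> nat \<times> real) measure" and Q F
    by measurable
  have "Measurable.pred (history_space n (t * J)) (\<lambda>h. i < t \<longrightarrow> \<not> passed (h (i * J + (J - 1))))" for i
  proof (cases "i < t")
    case True
    have neg: "Measurable.pred L (\<lambda>h. \<not> Q h)" if [measurable]: "Measurable.pred L Q"
      for L :: "(nat \<Rightarrow> real \<times> nat \<times> real) measure" and Q
      by measurable
    from neg[OF p[OF True]] True show ?thesis by (simp only: simp_thms)
  next
    case False
    then have "(\<lambda>h. i < t \<longrightarrow> \<not> passed (h (i * J + (J - 1)))) = (\<lambda>_. True)" by blast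
    then show ?thesis by (simp only: measurable_const space_count_space UNIV_I)
  qed
  from conj[OF this s] have "Measurable.pred (history_space n (t * J)) (undetected t)"
    unfolding undetected_def[abs_def] .
  moreover have "undetected t (restrict D {0..<t * J}) = undetected t D" for D
  proof -
    have "restrict D {0..<t * J} (i * J + (J - 1)) = D (i * J + (J - 1))" if "i < t" for i
      using block_end_less[OF that] by simp
    then show ?thesis
      unfolding undetected_def spent_restrict[OF order_refl] by metis
  qed
  ultimately show ?thesis by (simp add: history_event_def)
qed

text \<open>If the drawn entry lies in \<open>S\<close> and every decision of the block is correct,
  then by induction all rounds are measured and passed. The last pass contradicts
  \<open>undetected (Suc t) D\<close>.\<close>

lemma undetected_Suc:
  assumes D: "consistent D" and t: "t < T" and U: "undetected (Suc t) D"
  shows "undetected t D \<and> (fst (snd (D (t * J))) \<notin> S \<or>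
    (\<exists>j<J. fst (snd (D (t * J + j))) \<in> S \<and> snd (snd (D (t * J + j))) \<noteq> 0 \<and>
      (fst (D (t * J + j)) > \<mu> / 2 \<longleftrightarrow> fst (snd (D (t * J + j))) \<notin> S)))"
proof
  show "undetected t D"
    using U spent_mono[of "t * J" "Suc t * J" D] by (auto simp: undetected_def)
  show "fst (snd (D (t * J))) \<notin> S \<or>
    (\<exists>j<J. fst (snd (D (t * J + j))) \<in> S \<and> snd (snd (D (t * J + j))) \<noteq> 0 \<and>
      (fst (D (t * J + j)) > \<mu> / 2 \<longleftrightarrow> fst (snd (D (t * J + j))) \<notin> S))"
  proof (rule ccontr)
    assume neg: "\<not> ?thesis"
    have "passed (D (t * J + j))" if "j < J" for j
      using that
    proof (induction j)
      case (Suc j)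
      have "t * J + Suc j < Suc t * J" using Suc.prems by simp
      moreover have "Suc t * J \<le> T * J" using t by (intro mult_right_mono) auto
      \<comment> \<open>Funds left at the end \<open>Suc t * J\<close> of the block cover every
        round inside it.\<close>
      ultimately have "snd (snd (D (t * J + Suc j))) \<noteq> 0"
        using Suc U by (intro consistent_measured[OF D, of _ "Suc t * J"]) (auto simp: undetected_def)
      moreover have "fst (snd (D (t * J + Suc j))) \<in> S"
        using neg consistent_entry[OF D Suc.prems, of t] by auto
      ultimately have "fst (D (t * J + Suc j)) > \<mu> / 2"
        using neg Suc.prems by blast
      with \<open>snd (snd (D (t * J + Suc j))) \<noteq> 0\<close> show ?case by (simp add: passed_def)
    next
      case 0
      have "t * J < Suc t * J" using 0 by simp
      moreover have "Suc t * J \<le> T * J" using t by (intro mult_right_mono) auto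
      ultimately have "snd (snd (D (t * J + 0))) \<noteq> 0"
        using U t by (intro consistent_measured[OF D, of _ "Suc t * J"]) (auto simp: undetected_def)
      moreover have "fst (snd (D (t * J + 0))) \<in> S"
        using neg by auto
      ultimately have "fst (D (t * J + 0)) > \<mu> / 2"
        using neg 0 by blast
      with \<open>snd (snd (D (t * J + 0))) \<noteq> 0\<close> show ?case by (simp add: passed_def)
    qed
    from this[of "J - 1"] have "passed (D (t * J + (J - 1)))" using J by linarith
    then show False using U unfolding undetected_def by blast
  qed
qed

text \<open>With \<open>r = card S / n\<close>, the draw misses \<open>S\<close> with probability
  \<open>1 - r\<close>, independently of the past; on a hit some decision is wrong with probability
  at most \<open>1 / 2\<close>. This leaves the factor \<open>1 - r + r / 2\<close>.\<close>

lemma prob_undetected_Suc: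
  assumes S: "S \<subseteq> {1..n}" and t: "t < T"
  shows "\<P>(D in data_law n (signal \<mu> S) scan. undetected (Suc t) D)
    \<le> (1 - real (card S) / real n / 2) * \<P>(D in data_law n (signal \<mu> S) scan. undetected t D)"
proof -
  let ?M = "data_law n (signal \<mu> S) scan" and ?r = "real (card S) / real n"
  interpret prob_space ?M by (rule prob_space_scan)
  let ?U = "{D \<in> space ?M. undetected t D}"
  let ?A = "{D \<in> space ?M. undetected t D \<and> fst (snd (D (t * J))) \<notin> S}"
  let ?A' = "{D \<in> space ?M. undetected t D \<and> fst (snd (D (t * J + 0))) \<in> S}"
  let ?B = "\<lambda>j. {D \<in> space ?M. undetected t D \<and> (fst (snd (D (t * J + j))) \<in> S \<and> snd (snd (D (t * J + j))) \<noteq> 0 \<and>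
      (fst (D (t * J + j)) > \<mu> / 2 \<longleftrightarrow> fst (snd (D (t * J + j))) \<notin> S))}"
  have R: "history_event (t * J + j) (undetected t)" for j
    by (rule history_event_mono[OF history_event_undetected]) simp
  have U: "?U \<in> sets ?M" by (rule sets_history_event[OF R[of 0]])
  have A: "?A \<in> sets ?M"
    by (rule sets_history_event_step[OF history_event_undetected measurable_entry_pred])
  have A': "?A' \<in> sets ?M"
    by (rule sets_history_event_step[OF R measurable_entry_pred])
  have E: "Measurable.pred (step_space n) (\<lambda>y. fst (snd y) \<in> S \<and> snd (snd y) \<noteq> 0 \<and>
      (fst y > \<mu> / 2 \<longleftrightarrow> fst (snd y) \<notin> S))"
    by (rule measurable_wrong_decision_pred)
  have B: "?B j \<in> sets ?M" for j
    by (rule sets_history_event_step[OF R E])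
  have pA: "prob ?A = (1 - ?r) * prob ?U"
  proof -
    have "?A = ?U - ?A'" by auto
    then have "prob ?A = prob ?U - prob ?A'"
      using finite_measure_Diff[OF U A'] by auto
    also have "prob ?A' = ?r * prob ?U"
      using J by (intro prob_draw_block[OF history_event_undetected _ S]) simp
    finally show ?thesis by (simp add: algebra_simps)
  qed
  have pB: "prob (?B j) \<le> (1 / 4) ^ Suc j * (?r * prob ?U)" if j: "j < J" for j
  proof -
    have "prob (?B j) \<le> (1 / 4) ^ Suc j *
        \<P>(D in ?M. undetected t D \<and> (fst (snd (D (t * J + j))) \<in> S \<and> snd (snd (D (t * J + j))) \<noteq> 0))"
      using prob_wrong_decision_le[OF R[of j], where S = S and Q = "\<lambda>a. a \<in> S"] j by simp
    \<comment> \<open>Dropping the condition that the round was measured leaves an event of the draw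
      alone.\<close>
    also have "\<dots> \<le> (1 / 4) ^ Suc j * \<P>(D in ?M. undetected t D \<and> fst (snd (D (t * J + j))) \<in> S)"
      by (intro mult_left_mono finite_measure_mono sets_history_event_step[OF R measurable_entry_pred]) auto
    also have "\<P>(D in ?M. undetected t D \<and> fst (snd (D (t * J + j))) \<in> S) = ?r * prob ?U"
      by (rule prob_draw_block[OF history_event_undetected j S])
    finally show ?thesis .
  qed
  have "\<P>(D in ?M. undetected (Suc t) D) \<le> prob (?A \<union> (\<Union>j\<in>{..<J}. ?B j))"
  proof (rule finite_measure_mono_AE)
    show "AE D in ?M. D \<in> {D \<in> space ?M. undetected (Suc t) D} \<longrightarrow> D \<in> ?A \<union> (\<Union>j\<in>{..<J}. ?B j)"
      using AE_consistent
    proof eventually_elim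
      case (elim D)
      show ?case using undetected_Suc[OF elim t, of S] by auto
    qed
  qed (use A B in auto)
  also have "\<dots> \<le> prob ?A + prob (\<Union>j\<in>{..<J}. ?B j)"
    using A B by (intro measure_Un_le) auto
  also have "prob (\<Union>j\<in>{..<J}. ?B j) \<le> (\<Sum>j<J. prob (?B j))"
    using B by (intro finite_measure_subadditive_finite) auto
  also have "\<dots> \<le> (\<Sum>j<J. (1 / 4) ^ Suc j * (?r * prob ?U))"
    by (intro sum_mono pB) simp
  also have "\<dots> = (\<Sum>j<J. (1 / 4) ^ Suc j) * (?r * prob ?U)"
    by (rule sum_distrib_right[symmetric])
  also have "\<dots> \<le> 1 / 2 * (?r * prob ?U)"
    by (intro mult_right_mono sum_quarter_power_Suc) simp
  finally show ?thesis
    unfolding pA by (simp add: algebra_simps)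
qed

lemma prob_undetected_le:
  assumes S: "S \<subseteq> {1..n}" and "t \<le> T"
  shows "\<P>(D in data_law n (signal \<mu> S) scan. undetected t D) \<le> exp (- real t * (real (card S) / real n / 2))"
  using assms(2)
proof (induction t)
  case 0
  interpret prob_space "data_law n (signal \<mu> S) scan" by (rule prob_space_scan)
  show ?case by simp
next
  case (Suc t)
  let ?p = "\<lambda>t. \<P>(D in data_law n (signal \<mu> S) scan. undetected t D)" and ?q = "real (card S) / real n / 2"
  have "?p (Suc t) \<le> (1 - ?q) * ?p t"
    using Suc.prems by (intro prob_undetected_Suc[OF S]) simp
  also have "\<dots> \<le> exp (- ?q) * exp (- real t * ?q)"
    using Suc exp_ge_add_one_self[of "- ?q"] by (intro mult_mono) simp_all
  also have "\<dots> = exp (- real (Suc t) * ?q)"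
  proof -
    have "- q + - real t * q = - real (Suc t) * q" for q
      by (simp add: algebra_simps)
    then show ?thesis by (simp only: exp_add[symmetric])
  qed
  finally show ?case .
qed

section \<open>Error probabilities of the test\<close>

lemma is_test_scan_test: "is_test n scan_test"
proof -
  have p: "Measurable.pred (data_space n) (\<lambda>D. passed (D k))" for k
    unfolding data_space_def
    by (rule measurable_compose[OF measurable_step measurable_passed]) simp
  have ex: "(\<lambda>h. if \<exists>t<T. Q t h then 1 else 0 :: nat) \<in> L \<rightarrow>\<^sub>M count_space {0, 1}"
    if [measurable]: "\<And>t. Measurable.pred L (Q t)"
    for L :: "(nat \<Rightarrow> real \<times> nat \<times> real) measure" and Q
  proof (rule measurable_If)
    show "{h \<in> space L. \<exists>t<T. Q t h} \<in> sets L" by measurable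
  qed simp_all
  from ex[OF p] show ?thesis
    unfolding is_test_def scan_test_def[abs_def] .
qed

text \<open>For the empty support every pass is an error. Counting only the error of round
  \<open>J - 1\<close> gives \<open>(1 / 4) ^ J\<close> per block, and a union bound over the blocks
  finishes.\<close>

lemma prob_false_alarm_le:
  "measure (support_law n \<mu> scan {}) {D \<in> space (data_space n). scan_test D \<noteq> 0} \<le> real T * (1 / 4) ^ J"
proof -
  let ?M = "data_law n (signal \<mu> {}) scan"
  interpret prob_space ?M by (rule prob_space_scan)
  let ?A = "\<lambda>t. {D \<in> space ?M. passed (D (t * J + (J - 1)))}"
  have A: "?A t \<in> sets ?M" for t by (rule sets_step[OF measurable_passed])
  have pA: "prob (?A t) \<le> (1 / 4) ^ J" for t
  proof -
    have "prob (?A t) \<le> (1 / 4) ^ Suc (J - 1) * \<P>(D in ?M. snd (snd (D (t * J + (J - 1)))) \<noteq> 0)"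
      using prob_passed_null_le[of "J - 1" "{}" t] J by simp
    also have "\<dots> \<le> (1 / 4) ^ Suc (J - 1) * 1"
      by (intro mult_left_mono) simp_all
    finally show ?thesis using J by simp
  qed
  have "measure (support_law n \<mu> scan {}) {D \<in> space (data_space n). scan_test D \<noteq> 0} = prob (\<Union>t\<in>{..<T}. ?A t)"
    unfolding support_law_def space_data_law[of "signal \<mu> {}", symmetric]
    by (intro arg_cong[where f = prob]) (auto simp: scan_test_def)
  also have "\<dots> \<le> (\<Sum>t<T. prob (?A t))"
    using A by (intro finite_measure_subadditive_finite) auto
  also have "\<dots> \<le> (\<Sum>t<T. (1 / 4) ^ J)"
    by (intro sum_mono pA)
  finally show ?thesis by simp
qed

text \<open>A miss is either \<open>undetected\<close> or a path on which the last round, of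
  precision \<open>16 * real J / \<mu>\<^sup>2\<close>, no longer fits. Markov's inequality bounds
  the latter by the expected precision.\<close>

lemma prob_miss_le:
  assumes S: "S \<subseteq> {1..n}" and budget: "16 * real J / \<mu>\<^sup>2 < m"
  shows "measure (support_law n \<mu> scan S) {D \<in> space (data_space n). scan_test D \<noteq> 1} \<le>
    exp (- real T * (real (card S) / real n / 2)) +
    16 * real T / \<mu>\<^sup>2 * (2 + (real J)\<^sup>2 * (real (card S) / real n)) / (m - 16 * real J / \<mu>\<^sup>2)"
proof -
  let ?M = "data_law n (signal \<mu> S) scan"
  interpret prob_space ?M by (rule prob_space_scan)
  let ?U = "{D \<in> space ?M. undetected T D}"
  let ?c = "m - 16 * real J / \<mu>\<^sup>2"
  let ?V = "{D \<in> space ?M. spent (T * J) D \<ge> ?c}"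
  have c: "round_precision (J - 1) = 16 * real J / \<mu>\<^sup>2"
    using J by (simp add: round_precision_def of_nat_diff)
  have U: "?U \<in> sets ?M" by (rule sets_history_event[OF history_event_undetected])
  have V: "?V \<in> sets ?M"
    using borel_measurable_spent[of "T * J" "signal \<mu> S"] unfolding borel_measurable_iff_ge by blast
  have "measure (support_law n \<mu> scan S) {D \<in> space (data_space n). scan_test D \<noteq> 1} \<le> prob (?U \<union> ?V)"
    unfolding support_law_def space_data_law[of "signal \<mu> S", symmetric]
  proof (rule finite_measure_mono)
    show "{D \<in> space ?M. scan_test D \<noteq> 1} \<subseteq> ?U \<union> ?V"
    proof
      fix D assume "D \<in> {D \<in> space ?M. scan_test D \<noteq> 1}"
      then have D: "D \<in> space ?M" and "\<not> (\<exists>t<T. passed (D (t * J + (J - 1))))"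
        by (simp_all add: scan_test_def split: if_splits)
      then have "undetected T D \<or> spent (T * J) D \<ge> ?c"
        unfolding undetected_def c by (auto simp del: One_nat_def)
      then show "D \<in> ?U \<union> ?V" using D by blast
    qed
    show "?U \<union> ?V \<in> sets ?M" using U V by (rule sets.Un)
  qed
  also have "\<dots> \<le> prob ?U + prob ?V"
    by (rule measure_Un_le[OF U V])
  also have "prob ?U \<le> exp (- real T * (real (card S) / real n / 2))"
    by (rule prob_undetected_le[OF S]) simp
  also have "prob ?V \<le> expectation (spent (T * J)) / ?c"
  proof (rule integral_Markov_inequality_measure[OF expectation_spent_le(1)[OF S], of "{}"])
    show "AE D in ?M. 0 \<le> spent (T * J) D"
      by (intro AE_I2) (simp add: spent_def precision_nonneg sum_nonneg)
    show "0 < ?c" using budget by simp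
  qed simp
  also have "\<dots> \<le> 16 * real T / \<mu>\<^sup>2 * (2 + (real J)\<^sup>2 * (real (card S) / real n)) / ?c"
    using expectation_spent_le(2)[OF S] budget by (intro divide_right_mono) simp_all
  finally show ?thesis by simp
qed

end

section \<open>Risk of the scan\<close>

context sequential_scan
begin

lemma finite_support_class: "finite (support_class n s)"
  by (rule finite_subset[of _ "Pow {1..n}"]) (auto simp: support_class_def)

lemma support_class_nonempty: "s \<le> n \<Longrightarrow> support_class n s \<noteq> {}"
  using obtain_subset_with_card_n[of s "{1..n}"] by (auto simp: support_class_def)

text \<open>The lower half of the final sandwich. \<open>s \<le> n\<close> makes the class nonempty,
  so that the maximum is a genuine one.\<close>

lemma risk_scan_nonneg:
  assumes "s \<le> n"
  shows "0 \<le> risk n \<mu> (support_class n s) scan scan_test"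
proof -
  obtain S where "S \<in> support_class n s" using support_class_nonempty[OF assms] by blast
  then have "0 \<le> (MAX S\<in>support_class n s. measure (support_law n \<mu> scan S) {D \<in> space (data_space n). scan_test D \<noteq> 1})"
    using finite_support_class[of s] by (intro order_trans[OF measure_nonneg Max_ge]) auto
  then show ?thesis by (simp add: risk_def)
qed

lemma risk_scan_le:
  assumes s: "s \<le> n" and budget: "16 * real J / \<mu>\<^sup>2 < m"
  shows "risk n \<mu> (support_class n s) scan scan_test \<le> real T * (1 / 4) ^ J +
    (exp (- real T * (real s / real n / 2)) +
     16 * real T / \<mu>\<^sup>2 * (2 + (real J)\<^sup>2 * (real s / real n)) / (m - 16 * real J / \<mu>\<^sup>2))"
  unfolding risk_def
proof (rule add_mono[OF prob_false_alarm_le], rule Max.boundedI)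
  fix a
  assume "a \<in> (\<lambda>S. measure (support_law n \<mu> scan S) {D \<in> space (data_space n). scan_test D \<noteq> 1}) ` support_class n s"
  then obtain S where "S \<subseteq> {1..n}" "card S = s"
    and a: "a = measure (support_law n \<mu> scan S) {D \<in> space (data_space n). scan_test D \<noteq> 1}"
    by (auto simp: support_class_def)
  then show "a \<le> exp (- real T * (real s / real n / 2)) +
     16 * real T / \<mu>\<^sup>2 * (2 + (real J)\<^sup>2 * (real s / real n)) / (m - 16 * real J / \<mu>\<^sup>2)"
    using prob_miss_le[OF _ budget, of S] by simp
qed (use finite_support_class[of s] support_class_nonempty[OF s] in auto)

end

section \<open>Choice of parameters and the limit\<close>

text \<open>One number governs both parameters: \<open>J\<close> rounds and \<open>J\<^sup>2\<close>
  draws. As \<open>J\<^sup>2\<close> is at least \<open>\<kappa> * n / s\<close>, about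
  \<open>\<kappa>\<close> or more hits are expected, while \<open>J\<close> rounds outweigh the
  union bound over the draws. The three terms stand for false alarms, failed detection and a short
  budget.\<close>

lemma risk_scan_bound:
  fixes n s :: nat and m \<mu> L \<kappa> :: real
  defines "J \<equiv> nat \<lceil>sqrt (real n / real s * \<kappa>)\<rceil>"
  assumes s: "s \<in> {1..n}" and m: "m > 0" and \<mu>: "\<mu> > 0" and \<kappa>: "\<kappa> \<ge> 1" and L: "L > 2 * \<kappa>"
    and signal: "\<mu> > sqrt (32 * real n * L / (real s * m))"
  shows "risk n \<mu> (support_class n s) (sequential_scan.scan n J (J\<^sup>2) m \<mu>)
      (sequential_scan.scan_test J (J\<^sup>2) \<mu>) \<le>
    (real J)\<^sup>2 * (1 / 4) ^ J + (exp (- \<kappa> / 2) + 2 * \<kappa> * (2 + 4 * \<kappa>) / (L - 2 * \<kappa>))"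
proof -
  define r where "r = real n / real s"
  have r: "r \<ge> 1" using s by (simp add: r_def)
  \<comment> \<open>This lets rounding up cost at most a factor 2 in \<open>J\<close>, hence 4 in
    \<open>J\<^sup>2\<close>.\<close>
  have x: "r * \<kappa> \<ge> 1" using mult_mono[OF r \<kappa>] r by simp
  have J_ge: "sqrt (r * \<kappa>) \<le> real J" unfolding J_def r_def by (rule real_nat_ceiling_ge)
  then have J_ge_1: "1 \<le> real J" using x by (meson real_sqrt_ge_one order_trans)
  have "real J \<le> sqrt (r * \<kappa>) + 1"
    using x unfolding J_def r_def by (simp add: of_nat_nat)
  also have "\<dots> \<le> 2 * sqrt (r * \<kappa>)" using x by simp
  finally have "(real J)\<^sup>2 \<le> (2 * sqrt (r * \<kappa>))\<^sup>2" by (intro power_mono) simp_all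
  then have J2_le: "(real J)\<^sup>2 \<le> 4 * (r * \<kappa>)" using x by (simp add: power_mult_distrib)
  have J2_ge: "r * \<kappa> \<le> (real J)\<^sup>2"
    using power_mono[OF J_ge, of 2] x by simp
  have "real J \<le> (real J)\<^sup>2" using J_ge_1 by (rule self_le_power) simp
  with J2_le have J_le: "real J \<le> 4 * (r * \<kappa>)" by (rule order_trans[rotated])
  have "32 * r * L / m < \<mu>\<^sup>2"
  proof -
    have "0 \<le> 32 * real n * L / (real s * m)" using s m L \<kappa> by simp
    then have "32 * real n * L / (real s * m) < \<mu>\<^sup>2"
      using signal \<mu> by (metis real_sqrt_less_iff real_sqrt_pow2 real_sqrt_unique less_imp_le)
    then show ?thesis by (simp add: r_def)
  qed
  then have m_gt: "32 * r * L / \<mu>\<^sup>2 < m" using m \<mu> by (simp add: field_simps)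
  have gap: "0 < 32 * r * (L - 2 * \<kappa>) / \<mu>\<^sup>2" using r L \<mu> by simp
  have "16 * real J / \<mu>\<^sup>2 \<le> 64 * (r * \<kappa>) / \<mu>\<^sup>2"
    using J_le by (intro divide_right_mono) (simp_all add: mult.commute)
  \<comment> \<open>Reserving one last round costs at most
    \<open>64 * (r * \<kappa>) / \<mu>\<^sup>2\<close>, which is where \<open>2 * \<kappa>\<close>
    is lost from \<open>L\<close>.\<close>
  then have gap_le: "32 * r * (L - 2 * \<kappa>) / \<mu>\<^sup>2 \<le> m - 16 * real J / \<mu>\<^sup>2"
    using m_gt by (simp add: algebra_simps diff_divide_distrib)
  interpret sequential_scan n J "J\<^sup>2" m \<mu>
    by standard (use s m \<mu> J_ge_1 in auto)
  have "risk n \<mu> (support_class n s) scan scan_test \<le> real (J\<^sup>2) * (1 / 4) ^ J +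
    (exp (- real (J\<^sup>2) * (real s / real n / 2)) +
     16 * real (J\<^sup>2) / \<mu>\<^sup>2 * (2 + (real J)\<^sup>2 * (real s / real n)) / (m - 16 * real J / \<mu>\<^sup>2))"
    using s gap gap_le by (intro risk_scan_le) simp_all
  also have "\<dots> \<le> (real J)\<^sup>2 * (1 / 4) ^ J + (exp (- \<kappa> / 2) + 2 * \<kappa> * (2 + 4 * \<kappa>) / (L - 2 * \<kappa>))"
  proof (intro add_mono)
    have sr: "real s / real n = 1 / r" by (simp add: r_def)
    have "\<kappa> \<le> (real J)\<^sup>2 / r" using J2_ge r by (simp add: field_simps)
    then show "exp (- real (J\<^sup>2) * (real s / real n / 2)) \<le> exp (- \<kappa> / 2)"
      by (simp add: sr)
    have "16 * real (J\<^sup>2) / \<mu>\<^sup>2 * (2 + (real J)\<^sup>2 * (real s / real n)) \<le>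
        16 * (4 * (r * \<kappa>)) / \<mu>\<^sup>2 * (2 + 4 * \<kappa>)"
    proof (rule mult_mono)
      show "16 * real (J\<^sup>2) / \<mu>\<^sup>2 \<le> 16 * (4 * (r * \<kappa>)) / \<mu>\<^sup>2"
        using J2_le by (intro divide_right_mono) (simp_all add: mult.commute)
      show "2 + (real J)\<^sup>2 * (real s / real n) \<le> 2 + 4 * \<kappa>"
        using J2_le r by (simp add: sr field_simps)
    qed (use r \<kappa> in simp_all)
    then have "16 * real (J\<^sup>2) / \<mu>\<^sup>2 * (2 + (real J)\<^sup>2 * (real s / real n)) / (m - 16 * real J / \<mu>\<^sup>2) \<le>
        16 * (4 * (r * \<kappa>)) / \<mu>\<^sup>2 * (2 + 4 * \<kappa>) / (32 * r * (L - 2 * \<kappa>) / \<mu>\<^sup>2)"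
      using gap gap_le r \<kappa> by (intro frac_le) simp_all
    \<comment> \<open>Both \<open>r\<close> and \<open>\<mu>\<close> cancel, so the bound depends on
      \<open>n\<close>, \<open>s\<close>, \<open>m\<close> and \<open>\<mu>\<close> only through
      \<open>\<kappa>\<close>, \<open>L\<close> and \<open>J\<close>.\<close>
    also have "\<dots> = 2 * \<kappa> * (2 + 4 * \<kappa>) / (L - 2 * \<kappa>)"
      using r \<mu> L by (simp add: divide_simps)
    finally show "16 * real (J\<^sup>2) / \<mu>\<^sup>2 * (2 + (real J)\<^sup>2 * (real s / real n)) / (m - 16 * real J / \<mu>\<^sup>2) \<le>
        2 * \<kappa> * (2 + 4 * \<kappa>) / (L - 2 * \<kappa>)" .
  qed simp_all
  finally show ?thesis .
qed

theorem proposition3p3: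
  fixes s :: "nat \<Rightarrow> nat" and m \<mu> :: "nat \<Rightarrow> real" and N :: nat
  assumes "\<And>n. n \<ge> N \<Longrightarrow> s n \<in> {1..n}"
    and "\<And>n. n \<ge> N \<Longrightarrow> m n > 0"
    and "\<And>n. n \<ge> N \<Longrightarrow> \<mu> n > 0"
    and "\<And>n. n \<ge> N \<Longrightarrow> real (s n) > ln (ln (ln (real n)))"
    and "\<And>n. n \<ge> N \<Longrightarrow>
           \<mu> n > sqrt (32 * real n * ln (ln (ln (real n))) / (real (s n) * m n))"
  shows "\<exists>(K :: nat \<Rightarrow> sensing) (\<Phi> :: nat \<Rightarrow> (nat \<Rightarrow> real \<times> nat \<times> real) \<Rightarrow> nat).
           (\<forall>n\<ge>N. sensing_strategy n (K n) \<and> within_budget n (\<mu> n) (m n) (K n) \<and> is_test n (\<Phi> n)) \<and>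
           (\<lambda>n. risk n (\<mu> n) (support_class n (s n)) (K n) (\<Phi> n)) \<longlonglongrightarrow> 0"
proof -
  define L where "L n = ln (ln (ln (real n)))" for n :: nat
  \<comment> \<open>An exponent below \<open>1 / 2\<close> makes \<open>\<kappa>\<^sup>2 / L\<close>
    vanish. The maximum with 1 keeps \<open>J n \<ge> 1\<close>, hence a valid strategy, for every
    \<open>n \<ge> N\<close> and not just for large \<open>n\<close>.\<close>
  define \<kappa> where "\<kappa> n = max 1 (L n powr (1 / 3))" for n
  define J where "J n = nat \<lceil>sqrt (real n / real (s n) * \<kappa> n)\<rceil>" for n
  define K where "K n = sequential_scan.scan n (J n) ((J n)\<^sup>2) (m n) (\<mu> n)" for n
  define \<Phi> where "\<Phi> n = sequential_scan.scan_test (J n) ((J n)\<^sup>2) (\<mu> n)" for n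
  let ?R = "\<lambda>n. risk n (\<mu> n) (support_class n (s n)) (K n) (\<Phi> n)"
  \<comment> \<open>Since \<open>n / s \<ge> 1\<close>, \<open>J\<close> tends to infinity through
    \<open>\<kappa>\<close> alone, even when \<open>n / s\<close> stays bounded.\<close>
  have J_ge: "sqrt (\<kappa> n) \<le> real (J n)" if "n \<ge> N" for n
  proof -
    have "\<kappa> n * 1 \<le> \<kappa> n * (real n / real (s n))"
      using assms(1)[OF that] by (intro mult_left_mono) (auto simp: \<kappa>_def)
    then have "sqrt (\<kappa> n) \<le> sqrt (real n / real (s n) * \<kappa> n)" by (simp add: mult.commute)
    also have "\<dots> \<le> real (J n)" unfolding J_def by (rule real_nat_ceiling_ge)
    finally show ?thesis .
  qed
  have scan: "sequential_scan n (J n) (m n) (\<mu> n)" if "n \<ge> N" for n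
  proof
    have "1 \<le> sqrt (\<kappa> n)" by (simp add: \<kappa>_def)
    then show "1 \<le> J n" using J_ge[OF that] by linarith
  qed (use assms(1-3)[OF that] in auto)
  have L_top: "filterlim L at_top sequentially"
    unfolding L_def by real_asymp
  have \<kappa>_top: "filterlim \<kappa> at_top sequentially"
  proof -
    have "filterlim (\<lambda>x::real. max 1 (x powr (1 / 3))) at_top at_top" by real_asymp
    from filterlim_compose[OF this L_top] show ?thesis by (simp add: \<kappa>_def[abs_def])
  qed
  have J_top: "filterlim J at_top sequentially"
  proof -
    have "filterlim (\<lambda>n. sqrt (\<kappa> n)) at_top sequentially"
      by (rule filterlim_compose[OF sqrt_at_top \<kappa>_top])
    then have "filterlim (\<lambda>n. real (J n)) at_top sequentially"
      by (rule filterlim_at_top_mono) (use J_ge in \<open>auto simp: eventually_sequentially\<close>)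
    then show ?thesis by (simp add: filterlim_sequentially_iff_filterlim_real)
  qed
  have "(\<lambda>j::nat. (real j)\<^sup>2 * (1 / 4) ^ j) \<longlonglongrightarrow> 0" by real_asymp
  from filterlim_compose[OF this J_top]
  have lim1: "(\<lambda>n. (real (J n))\<^sup>2 * (1 / 4) ^ J n) \<longlonglongrightarrow> 0" .
  have "((\<lambda>x::real. exp (- x / 2)) \<longlongrightarrow> 0) at_top" by real_asymp
  from filterlim_compose[OF this \<kappa>_top]
  have lim2: "(\<lambda>n. exp (- \<kappa> n / 2)) \<longlonglongrightarrow> 0" .
  \<comment> \<open>The numerator is of order \<open>x powr (2 / 3)\<close>, the denominator of
    order \<open>x\<close>.\<close>
  have "((\<lambda>x::real. 2 * max 1 (x powr (1 / 3)) * (2 + 4 * max 1 (x powr (1 / 3))) / (x - 2 * max 1 (x powr (1 / 3)))) \<longlongrightarrow> 0) at_top"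
    by real_asymp
  from filterlim_compose[OF this L_top]
  have lim3: "(\<lambda>n. 2 * \<kappa> n * (2 + 4 * \<kappa> n) / (L n - 2 * \<kappa> n)) \<longlonglongrightarrow> 0"
    by (simp add: \<kappa>_def[abs_def])
  have "eventually (\<lambda>x::real. x > 2 * max 1 (x powr (1 / 3))) at_top" by real_asymp
  then have "eventually (\<lambda>n. L n > 2 * \<kappa> n) sequentially"
    unfolding \<kappa>_def by (rule eventually_compose_filterlim[OF _ L_top])
  then have upper: "eventually (\<lambda>n. ?R n \<le> (real (J n))\<^sup>2 * (1 / 4) ^ J n +
      (exp (- \<kappa> n / 2) + 2 * \<kappa> n * (2 + 4 * \<kappa> n) / (L n - 2 * \<kappa> n))) sequentially"
    using eventually_ge_at_top[of N]
  proof eventually_elim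
    case (elim n)
    have "1 \<le> \<kappa> n" by (simp add: \<kappa>_def)
    then show ?case
      unfolding K_def \<Phi>_def J_def
      using elim assms(1,2,3,5)[of n] by (intro risk_scan_bound) (simp_all add: L_def)
  qed
  have lower: "eventually (\<lambda>n. 0 \<le> ?R n) sequentially"
    using eventually_ge_at_top[of N]
  proof eventually_elim
    case (elim n)
    then show ?case
      unfolding K_def \<Phi>_def using sequential_scan.risk_scan_nonneg[OF scan] assms(1) by simp
  qed
  have "(\<lambda>n. (real (J n))\<^sup>2 * (1 / 4) ^ J n +
      (exp (- \<kappa> n / 2) + 2 * \<kappa> n * (2 + 4 * \<kappa> n) / (L n - 2 * \<kappa> n))) \<longlonglongrightarrow> 0"
    using tendsto_add[OF lim1 tendsto_add[OF lim2 lim3]] by simp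
  from tendsto_sandwich[OF lower upper tendsto_const this]
  have "?R \<longlonglongrightarrow> 0" .
  moreover have "sensing_strategy n (K n) \<and> within_budget n (\<mu> n) (m n) (K n) \<and> is_test n (\<Phi> n)"
    if "n \<ge> N" for n
    unfolding K_def \<Phi>_def
    using sequential_scan.sensing_strategy_scan[OF scan[OF that]]
      sequential_scan.within_budget_scan[OF scan[OF that]]
      sequential_scan.is_test_scan_test[OF scan[OF that]] by blast
  ultimately show ?thesis by blast
qed

end
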